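(* Let $(\Omega,d)$ be a metric space, $(X,Y)$ a random element of $\mathbb{R}^p\times\Omega$ with independent copy $(X',Y')$, and $\mathcal{H}_X$ the reproducing kernel Hilbert space generated by a positive definite kernel $\kappa_X$ on $\mathbb{R}^p$. With the notation of the context, suppose that: (i) $E\kappa_X(X,X)<\infty$; (ii) $\Lambda_{XX'}$ has a representation $\Lambda_{XX'}=\Sigma_{XX}S$, where $S:\mathcal{H}_X\to\mathcal{H}_X$ is a unique bounded linear operator with $S=Q_XSQ_X$, $Q_X$ being the projection operator of $\mathcal{H}_X$ onto $\overline{\mathrm{ran}}(\Sigma_{XX})$; (iii) $\mathcal{G}_{Y|X}$ is dense in $L_2(P_X|\mathcal{M}_{Y|X})$. Then $$\overline{\mathrm{ran}}\{\Sigma_{XX}^{-1}\Lambda_{XX'}\}\subseteq\mathcal{G}_{Y|X}.$$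
   Context: $\mu_X(\cdot)=E\kappa_X(\cdot,X)$; for $a,b\in\mathcal{H}_X$, $a\otimes b$ is the operator $f\mapsto\langle b,f\rangle_{\mathcal{H}_X}a$. The covariance operator is $\Sigma_{XX}=E\{\kappa_X(\cdot,X)\otimes\kappa_X(\cdot,X)\}-\mu_X\otimes\mu_X$, and the weighted inverse regression ensemble operator is $\Lambda_{XX'}=-E\{(\kappa_X(\cdot,X)-\mu_X)\otimes(\kappa_X(\cdot,X')-\mu_X)\,d(Y,Y')\}$ (assumed well defined). $\overline{\mathrm{ran}}$ denotes the closure of the range. $\Sigma_{XX}^{-1}\Lambda_{XX'}$ is understood as the operator $S$ of (ii). Central class: nonlinear sufficient dimension reduction seeks a function $f:\mathbb{R}^p\to\mathbb{R}^d$ such that $Y$ and $X$ are conditionally independent given $f(X)$. $\mathcal{M}_{Y|X}=\sigma[f(X)]$ is the smallest $\sigma$-field of this form (assumed to exist), and the central class $\mathcal{G}_{Y|X}$ is the corresponding smallest subspace, i.e. the class of functions in $\mathcal{H}_X$ that are measurable with respect to $\mathcal{M}_{Y|X}$. $L_2(P_X)$ is the space of square-integrable functions of $X$ and $L_2(P_X|\mathcal{M}_{Y|X})$ is the collection of $\mathcal{M}_{Y|X}$-measurable functions in $L_2(P_X)$. *)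

theory Defs
  imports "HOL-Probability.Probability"
begin

definition positive_definite_kernel :: "('x \<Rightarrow> 'x \<Rightarrow> real) \<Rightarrow> bool" where
  "positive_definite_kernel \<kappa> \<longleftrightarrow>
     (\<forall>x y. \<kappa> x y = \<kappa> y x) \<and>
     (\<forall>A c. finite A \<longrightarrow> (\<Sum>x\<in>A. \<Sum>y\<in>A. c x * c y * \<kappa> x y) \<ge> 0)"

text \<open>
  A Hilbert space of functions on \<open>'x\<close> is a complete inner product space \<open>'h\<close> together with a
  linear injection \<open>val\<close> that identifies each \<open>h :: 'h\<close> with the function \<open>val h\<close>.
  Under this identification \<open>kernel_section val \<kappa> x\<close> is the function \<open>\<kappa>(\<sqdot>, x)\<close>.
\<close>

definition kernel_section :: "('h \<Rightarrow> 'x \<Rightarrow> real) \<Rightarrow> ('x \<Rightarrow> 'x \<Rightarrow> real) \<Rightarrow> 'x \<Rightarrow> 'h" where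
  "kernel_section val \<kappa> x = inv val (\<lambda>y. \<kappa> y x)"

definition is_rkhs ::
  "('h::{real_inner,complete_space} \<Rightarrow> 'x \<Rightarrow> real) \<Rightarrow> ('x \<Rightarrow> 'x \<Rightarrow> real) \<Rightarrow> bool" where
  "is_rkhs val \<kappa> \<longleftrightarrow>
     inj val \<and>
     (\<forall>f g x. val (f + g) x = val f x + val g x) \<and>
     (\<forall>c f x. val (c *\<^sub>R f) x = c * val f x) \<and>
     (\<forall>x. (\<lambda>y. \<kappa> y x) \<in> range val) \<and>
     (\<forall>f x. val f x = f \<bullet> kernel_section val \<kappa> x)"

definition tensor :: "'h::real_inner \<Rightarrow> 'h \<Rightarrow> 'h \<Rightarrow> 'h" where
  "tensor a b = (\<lambda>f. (b \<bullet> f) *\<^sub>R a)"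

definition orth_proj :: "'h::real_inner set \<Rightarrow> 'h \<Rightarrow> 'h" where
  "orth_proj V h = (THE v. v \<in> V \<and> (\<forall>u\<in>V. orthogonal (h - v) u))"

text \<open>
  Expectations are taken in the weak (Pettis) sense: no separability of \<open>'h\<close> is needed, and they
  agree with Bochner expectations whenever the latter exist.
  The expectation of a random operator is taken pointwise.
\<close>

definition weakly_integrable :: "'w measure \<Rightarrow> ('w \<Rightarrow> 'h::real_inner) \<Rightarrow> bool" where
  "weakly_integrable M F \<longleftrightarrow>
     (\<forall>f. integrable M (\<lambda>\<omega>. f \<bullet> F \<omega>)) \<and> (\<exists>v. \<forall>f. f \<bullet> v = (\<integral>\<omega>. f \<bullet> F \<omega> \<partial>M))"

definition expect :: "'w measure \<Rightarrow> ('w \<Rightarrow> 'h::real_inner) \<Rightarrow> 'h" where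
  "expect M F = (THE v. \<forall>f. f \<bullet> v = (\<integral>\<omega>. f \<bullet> F \<omega> \<partial>M))"

definition expect_op :: "'w measure \<Rightarrow> ('w \<Rightarrow> 'h::real_inner \<Rightarrow> 'h) \<Rightarrow> 'h \<Rightarrow> 'h" where
  "expect_op M T = (\<lambda>g. expect M (\<lambda>\<omega>. T \<omega> g))"

text \<open>In the following, \<open>k x\<close> plays the role of \<open>\<kappa>(\<sqdot>, x)\<close>.\<close>

definition mean_element :: "'w measure \<Rightarrow> ('x \<Rightarrow> 'h::real_inner) \<Rightarrow> ('w \<Rightarrow> 'x) \<Rightarrow> 'h" where
  "mean_element M k X = expect M (\<lambda>\<omega>. k (X \<omega>))"

definition cov_op :: "'w measure \<Rightarrow> ('x \<Rightarrow> 'h::real_inner) \<Rightarrow> ('w \<Rightarrow> 'x) \<Rightarrow> 'h \<Rightarrow> 'h" where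
  "cov_op M k X =
     (\<lambda>g. expect_op M (\<lambda>\<omega>. tensor (k (X \<omega>)) (k (X \<omega>))) g
           - tensor (mean_element M k X) (mean_element M k X) g)"

definition wire_integrand ::
  "'w measure \<Rightarrow> ('x \<Rightarrow> 'h::real_inner) \<Rightarrow> ('w \<Rightarrow> 'x) \<Rightarrow> ('w \<Rightarrow> 'y::metric_space) \<Rightarrow>
   ('w \<Rightarrow> 'x) \<Rightarrow> ('w \<Rightarrow> 'y) \<Rightarrow> 'w \<Rightarrow> 'h \<Rightarrow> 'h" where
  "wire_integrand M k X Y X' Y' \<omega> =
     (\<lambda>g. dist (Y \<omega>) (Y' \<omega>) *\<^sub>R
        tensor (k (X \<omega>) - mean_element M k X) (k (X' \<omega>) - mean_element M k X) g)"

definition wire_op ::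
  "'w measure \<Rightarrow> ('x \<Rightarrow> 'h::real_inner) \<Rightarrow> ('w \<Rightarrow> 'x) \<Rightarrow> ('w \<Rightarrow> 'y::metric_space) \<Rightarrow>
   ('w \<Rightarrow> 'x) \<Rightarrow> ('w \<Rightarrow> 'y) \<Rightarrow> 'h \<Rightarrow> 'h" where
  "wire_op M k X Y X' Y' = (\<lambda>g. - expect_op M (wire_integrand M k X Y X' Y') g)"

definition is_inverse_representation ::
  "('h::real_inner \<Rightarrow> 'h) \<Rightarrow> ('h \<Rightarrow> 'h) \<Rightarrow> ('h \<Rightarrow> 'h) \<Rightarrow> bool" where
  "is_inverse_representation \<Sigma> \<Lambda> S \<longleftrightarrow>
     (let Q = orth_proj (closure (range \<Sigma>)) in
        bounded_linear S \<and> \<Lambda> = \<Sigma> \<circ> S \<and> S = Q \<circ> S \<circ> Q)"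

definition inverse_comp :: "('h::real_inner \<Rightarrow> 'h) \<Rightarrow> ('h \<Rightarrow> 'h) \<Rightarrow> 'h \<Rightarrow> 'h" where
  "inverse_comp \<Sigma> \<Lambda> = (THE S. is_inverse_representation \<Sigma> \<Lambda> S)"

text \<open>
  The sigma-field generated by \<open>Z\<close>, augmented by the null events.  All inclusions between and
  measurability with respect to sigma-fields of the form \<open>\<sigma>[f(X)]\<close> are meant up to null events:
  altering \<open>f\<close> on a null set changes \<open>\<sigma>[f(X)]\<close> but not the conditional independence it encodes,
  so without the augmentation a smallest such sigma-field would exist only in degenerate cases.
\<close>

definition generated_field :: "'w measure \<Rightarrow> ('w \<Rightarrow> 'z) \<Rightarrow> 'z measure \<Rightarrow> 'w measure" where
  "generated_field M Z N =
     sigma (space M) ({Z -` A \<inter> space M | A. A \<in> sets N} \<union> null_sets M)"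

definition cond_independent ::
  "'w measure \<Rightarrow> 'w measure \<Rightarrow> ('w \<Rightarrow> 'y) \<Rightarrow> 'y measure \<Rightarrow> ('w \<Rightarrow> 'x) \<Rightarrow> 'x measure \<Rightarrow> bool" where
  "cond_independent M F Y NY X NX \<longleftrightarrow>
     (\<forall>A\<in>sets NY. \<forall>B\<in>sets NX. AE \<omega> in M.
        real_cond_exp M F (\<lambda>\<omega>. indicator A (Y \<omega>) * indicator B (X \<omega>)) \<omega> =
        real_cond_exp M F (\<lambda>\<omega>. indicator A (Y \<omega>)) \<omega> *
        real_cond_exp M F (\<lambda>\<omega>. indicator B (X \<omega>)) \<omega>)"

definition sdr_map ::
  "'w measure \<Rightarrow> ('w \<Rightarrow> real^'p) \<Rightarrow> ('w \<Rightarrow> 'y::topological_space) \<Rightarrow> (real^'p \<Rightarrow> real^'d) \<Rightarrow> bool"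
  where
  "sdr_map M X Y f \<longleftrightarrow>
     f \<in> borel_measurable borel \<and>
     cond_independent M (generated_field M (\<lambda>\<omega>. f (X \<omega>)) borel) Y borel X borel"

definition central_sdr_map ::
  "'w measure \<Rightarrow> ('w \<Rightarrow> real^'p) \<Rightarrow> ('w \<Rightarrow> 'y::topological_space) \<Rightarrow> (real^'p \<Rightarrow> real^'d) \<Rightarrow> bool"
  where
  "central_sdr_map M X Y f \<longleftrightarrow>
     sdr_map M X Y f \<and>
     (\<forall>g :: real^'p \<Rightarrow> real^'d. sdr_map M X Y g \<longrightarrow>
        sets (generated_field M (\<lambda>\<omega>. f (X \<omega>)) borel)
          \<subseteq> sets (generated_field M (\<lambda>\<omega>. g (X \<omega>)) borel))"

definition central_class ::
  "('h \<Rightarrow> 'x \<Rightarrow> real) \<Rightarrow> ('w \<Rightarrow> 'x) \<Rightarrow> 'w measure \<Rightarrow> 'h set" where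
  "central_class val X F = {h. (\<lambda>\<omega>. val h (X \<omega>)) \<in> borel_measurable F}"

definition L2_functions :: "'x measure \<Rightarrow> ('x \<Rightarrow> real) set" where
  "L2_functions P = {\<phi> \<in> borel_measurable P. integrable P (\<lambda>x. (\<phi> x)\<^sup>2)}"

definition L2_measurable_functions ::
  "'w measure \<Rightarrow> ('w \<Rightarrow> 'x::topological_space) \<Rightarrow> 'w measure \<Rightarrow> ('x \<Rightarrow> real) set" where
  "L2_measurable_functions M X F =
     {\<phi> \<in> L2_functions (distr M borel X). (\<lambda>\<omega>. \<phi> (X \<omega>)) \<in> borel_measurable F}"

definition L2_dense_in :: "'x measure \<Rightarrow> ('x \<Rightarrow> real) set \<Rightarrow> ('x \<Rightarrow> real) set \<Rightarrow> bool" where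
  "L2_dense_in P G T \<longleftrightarrow>
     G \<subseteq> T \<and> (\<forall>\<phi>\<in>T. \<forall>\<epsilon>>0. \<exists>g\<in>G. sqrt (\<integral>x. (\<phi> x - g x)\<^sup>2 \<partial>P) < \<epsilon>)"

end

theory Submission
  imports Defs
begin

text \<open>
  Write \<open>S g = u\<close>, and let \<open>h0 = h - E h(X)\<close>, and similarly for \<open>g\<close> and \<open>u\<close>. For every \<open>h\<close>,
  \<open>Cov(h(X), u(X)) = - E[h0(X) g0(X') d(Y, Y')]\<close>. Since \<open>E g0(X') = 0\<close>, the distance may be replaced
  by \<open>d(Y, Y') - d(Y, y0)\<close>, which is at most \<open>d(Y', y0)\<close> in absolute value; integrating out \<open>(X', Y')\<close>
  turns the right-hand side into \<open>- E[h0(X) a(Y)]\<close> with \<open>a\<close> bounded.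
  Conditional independence allows \<open>a(Y)\<close> to be replaced by \<open>w = E[a(Y) | F]\<close>. Hence
  \<open>r = u0(X) + w - E w\<close> is orthogonal to all \<open>h(X)\<close>, and because \<open>G\<close> is dense in \<open>L\<^sub>2(F)\<close> it is also
  orthogonal to \<open>w - E w\<close>, so \<open>r = 0\<close> and \<open>u(X)\<close> is \<open>F\<close>-measurable. Finally \<open>G\<close> is closed, as norm
  convergence in the Hilbert space implies pointwise convergence.
\<close>

section \<open>Riesz representation on closed subspaces\<close>

text \<open>The representing element is the minimizer of \<open>u \<bullet> u / 2 - \<phi> u\<close> over \<open>V\<close>.\<close>

lemma riesz_closed_subspace:
  fixes V :: "'h::{real_inner,complete_space} set" and \<phi> :: "'h \<Rightarrow> real"
  assumes V: "subspace V" "closed V" and \<phi>: "bounded_linear \<phi>"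
  obtains v where "v \<in> V" "\<And>u. u \<in> V \<Longrightarrow> u \<bullet> v = \<phi> u"
proof -
  interpret \<phi>: bounded_linear \<phi> by fact
  define J where "J u = u \<bullet> u / 2 - \<phi> u" for u
  obtain K where K: "\<And>u. norm (\<phi> u) \<le> norm u * K" using \<phi>.bounded by blast
  \<comment> \<open>Completing the square: with \<open>t = norm u\<close>, \<open>J u\<close> is at
    least \<open>t\<^sup>2 / 2 - K * t\<close>, whose minimum over real \<open>t\<close> is
    \<open>- (K\<^sup>2 / 2)\<close>.\<close>
  have J_ge: "- (K\<^sup>2 / 2) \<le> J u" for u
  proof -
    have "0 \<le> (norm u - K)\<^sup>2" by simp
    moreover have "\<phi> u \<le> norm u * K" using K[of u] by auto
    ultimately show ?thesis
      by (simp add: J_def dot_square_norm power2_diff)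
  qed
  define m where "m = Inf (J ` V)"
  have ne: "V \<noteq> {}" using subspace_0[OF V(1)] by auto
  have bdd: "bdd_below (J ` V)" using J_ge by (auto intro!: bdd_belowI)
  have m_le: "m \<le> J u" if "u \<in> V" for u
    unfolding m_def using that bdd by (intro cInf_lower) auto
  have "\<exists>u\<in>V. J u < m + inverse (real (Suc n))" for n
    using cInf_lessD[of "J ` V" "m + inverse (real (Suc n))"] ne by (auto simp: m_def)
  then obtain s where s: "\<And>n. s n \<in> V" "\<And>n. J (s n) < m + inverse (real (Suc n))" by metis
  define r where "r n = inverse (real (Suc n))" for n
  have r: "r \<longlonglongrightarrow> 0" unfolding r_def by (rule LIMSEQ_inverse_real_of_nat)
  have J_s: "J (s n) \<le> m + r n" for n using s(2)[of n] by (simp add: r_def)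
  \<comment> \<open>Parallelogram law; the linear part \<phi> cancels. The midpoint of two points of
    \<open>V\<close> lies in \<open>V\<close>, where \<open>J\<close> is at least \<open>m\<close>,
    so near-minimizers are close to each other and \<open>s\<close> is Cauchy.\<close>
  have par: "(norm (a - b))\<^sup>2 / 4 = J a + J b - 2 * J ((1/2) *\<^sub>R (a + b))" for a b
    by (simp add: J_def \<phi>.scaleR \<phi>.add dot_square_norm[symmetric] inner_simps inner_commute field_simps)
  have dist_s: "(dist (s i) (s j))\<^sup>2 \<le> 4 * (r i + r j)" for i j
  proof -
    have "(1/2) *\<^sub>R (s i + s j) \<in> V"
      using s V by (intro subspace_scale subspace_add)
    from m_le[OF this] par[of "s i" "s j"] J_s[of i] J_s[of j]
    have "(norm (s i - s j))\<^sup>2 / 4 \<le> r i + r j" by argo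
    then show ?thesis by (simp add: dist_norm)
  qed
  have "Cauchy s"
  proof (rule metric_CauchyI)
    fix e :: real assume "0 < e"
    then have "\<forall>\<^sub>F n in sequentially. r n < e\<^sup>2 / 8" by (intro order_tendstoD(2)[OF r]) simp
    then obtain N where N: "\<And>n. N \<le> n \<Longrightarrow> r n < e\<^sup>2 / 8"
      unfolding eventually_sequentially by blast
    have "dist (s i) (s j) < e" if "N \<le> i" "N \<le> j" for i j
    proof -
      have "(dist (s i) (s j))\<^sup>2 < e\<^sup>2" using dist_s[of i j] N[OF that(1)] N[OF that(2)] by argo
      then show ?thesis using \<open>0 < e\<close> by (simp add: power2_less_imp_less)
    qed
    then show "\<exists>N. \<forall>i\<ge>N. \<forall>j\<ge>N. dist (s i) (s j) < e" by blast
  qed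
  then obtain v where v: "s \<longlonglongrightarrow> v" using Cauchy_convergent convergent_def by blast
  have vV: "v \<in> V" using V(2) s(1) v unfolding closed_sequential_limits by blast
  have "(\<lambda>n. J (s n)) \<longlonglongrightarrow> J v"
    unfolding J_def by (intro tendsto_intros v \<phi>.tendsto) simp
  moreover have "(\<lambda>n. m + r n) \<longlonglongrightarrow> m + 0" by (intro tendsto_intros r)
  ultimately have "J v \<le> m + 0" by (rule LIMSEQ_le) (simp add: J_s)
  then have Jv: "J v \<le> m" by simp
  have "u \<bullet> v = \<phi> u" if u: "u \<in> V" for u
  proof (cases "u = 0")
    case False
    \<comment> \<open>\<open>c\<close> minimizes \<open>J (v + t *\<^sub>R u)\<close> over real
      \<open>t\<close>. The change of value there is
      \<open>- (\<phi> u - u \<bullet> v)\<^sup>2 / (2 * (u \<bullet> u))\<close>, which minimality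
      of \<open>v\<close> forces to be zero.\<close>
    define c where "c = (\<phi> u - u \<bullet> v) / (u \<bullet> u)"
    have "v + c *\<^sub>R u \<in> V" using V vV u by (intro subspace_add subspace_scale)
    from m_le[OF this] Jv have "J v \<le> J (v + c *\<^sub>R u)" by argo
    also have "J (v + c *\<^sub>R u) = J v + (c\<^sup>2 * (u \<bullet> u) / 2 - c * (\<phi> u - u \<bullet> v))"
      unfolding J_def \<phi>.add \<phi>.scaleR inner_add_left inner_add_right inner_scaleR_left
        inner_scaleR_right inner_commute[of v u] real_scaleR_def power2_eq_square
      by (simp add: field_simps)
    also have "c\<^sup>2 * (u \<bullet> u) = c * (\<phi> u - u \<bullet> v)"
      using False by (simp add: c_def power2_eq_square)
    finally have "c * (\<phi> u - u \<bullet> v) \<le> 0" by argo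
    then have "(\<phi> u - u \<bullet> v)\<^sup>2 / (u \<bullet> u) \<le> 0" by (simp add: c_def power2_eq_square)
    then show ?thesis using False by (auto simp: divide_le_0_iff not_le simp flip: inner_gt_zero_iff)
  qed (simp add: \<phi>.zero)
  with vV show ?thesis by (rule that)
qed

section \<open>Point evaluation and measurability in the reproducing kernel Hilbert space\<close>

text \<open>\<open>inv val\<close> is meaningful only on the range of \<open>val\<close>;
  \<open>is_rkhs\<close> places every kernel section there.\<close>

lemma rkhs_kernel_section:
  assumes "is_rkhs val \<kappa>"
  shows "val (kernel_section val \<kappa> x) = (\<lambda>y. \<kappa> y x)"
  using assms unfolding is_rkhs_def kernel_section_def by (metis f_inv_into_f)

lemma rkhs_val_eq:
  assumes "is_rkhs val \<kappa>"
  shows "val h x = h \<bullet> kernel_section val \<kappa> x"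
  using assms unfolding is_rkhs_def by blast

lemma rkhs_val_zero: "is_rkhs val \<kappa> \<Longrightarrow> val 0 = (\<lambda>x. 0)"
  and rkhs_val_add: "is_rkhs val \<kappa> \<Longrightarrow> val (f + g) = (\<lambda>x. val f x + val g x)"
  and rkhs_val_scaleR: "is_rkhs val \<kappa> \<Longrightarrow> val (c *\<^sub>R f) = (\<lambda>x. c * val f x)"
  by (rule ext, simp only: rkhs_val_eq[of val \<kappa>] inner_simps inner_zero_left real_scaleR_def)+

lemma rkhs_norm_kernel_section:
  assumes "is_rkhs val \<kappa>"
  shows "(norm (kernel_section val \<kappa> x))\<^sup>2 = \<kappa> x x"
  by (simp only: power2_norm_eq_inner rkhs_kernel_section[OF assms] flip: rkhs_val_eq[OF assms])

lemma rkhs_val_tendsto: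
  assumes "is_rkhs val \<kappa>" "s \<longlonglongrightarrow> h"
  shows "(\<lambda>n. val (s n) x) \<longlonglongrightarrow> val h x"
  by (subst (1 2) rkhs_val_eq[OF assms(1)]) (intro tendsto_inner assms(2) tendsto_const)

text \<open>Norm convergence implies pointwise convergence by the reproducing property, and
  pointwise limits preserve measurability. With the identity for \<open>X\<close> this concerns the
  elements as functions; with the random element \<open>X\<close> it is the closedness of the
  central class.\<close>

lemma rkhs_closed_measurable:
  assumes "is_rkhs val \<kappa>"
  shows "closed {h. (\<lambda>\<omega>. val h (X \<omega>)) \<in> borel_measurable F}"
  unfolding closed_sequential_limits
proof (intro allI impI, elim conjE)
  fix s h assume s: "\<forall>n. s n \<in> {h. (\<lambda>\<omega>. val h (X \<omega>)) \<in> borel_measurable F}" "s \<longlonglongrightarrow> h"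
  have "(\<lambda>\<omega>. val h (X \<omega>)) \<in> borel_measurable F"
  proof (rule borel_measurable_LIMSEQ_metric)
    show "(\<lambda>\<omega>. val (s n) (X \<omega>)) \<in> borel_measurable F" for n using s(1) by simp
  qed (rule rkhs_val_tendsto[OF assms s(2)])
  then show "h \<in> {h. (\<lambda>\<omega>. val h (X \<omega>)) \<in> borel_measurable F}" by simp
qed

text \<open>The measurable elements form a closed subspace whose orthogonal complement is trivial,
  because it contains every kernel section.\<close>

lemma rkhs_val_measurable:
  fixes val :: "'h::{real_inner,complete_space} \<Rightarrow> 'x \<Rightarrow> real"
  assumes rkhs: "is_rkhs val \<kappa>" and meas: "\<And>x. (\<lambda>y. \<kappa> y x) \<in> borel_measurable N"
  shows "val h \<in> borel_measurable N"
proof -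
  let ?V = "{h. val h \<in> borel_measurable N}"
  have "closed ?V" using rkhs_closed_measurable[OF rkhs, of "\<lambda>x. x"] by simp
  moreover have "subspace ?V"
    unfolding subspace_def
    by (auto simp: rkhs_val_zero[OF rkhs] rkhs_val_add[OF rkhs] rkhs_val_scaleR[OF rkhs])
  \<comment> \<open>\<open>v\<close> is the orthogonal projection of \<open>h\<close> onto the
    measurable elements. All kernel sections lie among these, so \<open>v\<close> and
    \<open>h\<close> have the same values.\<close>
  ultimately obtain v where v: "v \<in> ?V" "\<And>u. u \<in> ?V \<Longrightarrow> u \<bullet> v = h \<bullet> u"
    using riesz_closed_subspace[of ?V "\<lambda>u. h \<bullet> u"] bounded_linear_inner_right by blast
  have "val v x = val h x" for x
  proof -
    have "val v x = kernel_section val \<kappa> x \<bullet> v"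
      by (simp only: rkhs_val_eq[OF rkhs] inner_commute)
    also have "\<dots> = val h x"
      using v(2)[of "kernel_section val \<kappa> x"] meas[of x]
      by (simp add: rkhs_kernel_section[OF rkhs] flip: rkhs_val_eq[OF rkhs])
    finally show ?thesis .
  qed
  then have "val h = val v" by auto
  then show ?thesis using v(1) by simp
qed

section \<open>Expectations in the weak sense\<close>

text \<open>The difference of two such vectors is orthogonal to every \<open>f\<close>, in
  particular to itself. Hence the definite description in \<open>expect\<close> is evaluated by
  exhibiting one representing vector.\<close>

lemma expect_eqI:
  assumes "\<And>f. f \<bullet> v = (\<integral>\<omega>. f \<bullet> Z \<omega> \<partial>M)"
  shows "expect M Z = v"
  unfolding expect_def
proof (rule the_equality)
  fix w assume "\<forall>f. f \<bullet> w = (\<integral>\<omega>. f \<bullet> Z \<omega> \<partial>M)"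
  then have "(w - v) \<bullet> (w - v) = 0" using assms by (simp add: inner_simps)
  then show "w = v" by simp
qed (use assms in blast)

lemma inner_expect_weakly_integrable:
  assumes "weakly_integrable M Z"
  shows "f \<bullet> expect M Z = (\<integral>\<omega>. f \<bullet> Z \<omega> \<partial>M)"
proof -
  obtain v where v: "\<And>f. f \<bullet> v = (\<integral>\<omega>. f \<bullet> Z \<omega> \<partial>M)"
    using assms unfolding weakly_integrable_def by blast
  from expect_eqI[of v, OF v] v show ?thesis by simp
qed

text \<open>Domination by \<open>B\<close> makes the integral of
  \<open>f \<bullet> Z \<omega>\<close> a bounded linear functional of \<open>f\<close>, and Riesz
  representation on the whole space supplies the expectation.\<close>

lemma weakly_integrableI:
  fixes Z :: "'w \<Rightarrow> 'h::{real_inner,complete_space}"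
  assumes int: "\<And>f. integrable M (\<lambda>\<omega>. f \<bullet> Z \<omega>)"
    and B: "integrable M B" "\<And>f \<omega>. \<bar>f \<bullet> Z \<omega>\<bar> \<le> norm f * B \<omega>"
  shows "weakly_integrable M Z"
proof -
  have "bounded_linear (\<lambda>f. \<integral>\<omega>. f \<bullet> Z \<omega> \<partial>M)"
  proof (rule bounded_linear_intro)
    show "norm (\<integral>\<omega>. f \<bullet> Z \<omega> \<partial>M) \<le> norm f * (\<integral>\<omega>. B \<omega> \<partial>M)" for f
    proof -
      have "norm (\<integral>\<omega>. f \<bullet> Z \<omega> \<partial>M) \<le> (\<integral>\<omega>. norm (f \<bullet> Z \<omega>) \<partial>M)" by simp
      also have "\<dots> \<le> (\<integral>\<omega>. norm f * B \<omega> \<partial>M)"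
        using int B by (intro integral_mono) auto
      finally show ?thesis by simp
    qed
  qed (simp_all add: inner_simps int)
  then obtain v where "\<And>f. f \<bullet> v = (\<integral>\<omega>. f \<bullet> Z \<omega> \<partial>M)"
    using riesz_closed_subspace[of UNIV "\<lambda>f. \<integral>\<omega>. f \<bullet> Z \<omega> \<partial>M"] by auto
  with int show ?thesis unfolding weakly_integrable_def by auto
qed

section \<open>Sigma-fields generated up to null events\<close>

lemma space_generated_field [simp]: "space (generated_field M Z N) = space M"
  and sets_generated_field:
    "Z \<in> measurable M N \<Longrightarrow> sets (generated_field M Z N) =
       sigma_sets (space M) ({Z -` A \<inter> space M | A. A \<in> sets N} \<union> null_sets M)"
  unfolding generated_field_def
  by (auto intro!: space_measure_of sets_measure_of dest: sets.sets_into_space[OF null_setsD2])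

lemma subalgebra_generated_field:
  assumes "Z \<in> measurable M N"
  shows "subalgebra M (generated_field M Z N)"
  unfolding subalgebra_def sets_generated_field[OF assms] space_generated_field
  using assms by (auto intro!: sets.sigma_sets_subset measurable_sets)

lemma measurable_generated_field_comp:
  assumes Z: "Z \<in> measurable M N" and \<psi>: "\<psi> \<in> measurable N K"
  shows "(\<lambda>\<omega>. \<psi> (Z \<omega>)) \<in> measurable (generated_field M Z N) K"
proof (rule measurable_compose[OF _ \<psi>])
  show "Z \<in> measurable (generated_field M Z N) N"
    using Z by (intro measurableI) (auto simp: sets_generated_field[OF Z] dest: measurable_space)
qed

text \<open>Preimages under \<phi> and \<psi> differ only inside the null set \<open>E\<close>, and
  the part of a \<psi>-preimage inside \<open>E\<close> is again a null event, hence in the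
  augmented field. Since \<open>M\<close> need not be complete, measurability of \<psi> for
  \<open>M\<close> is what makes that part an event.\<close>

lemma measurable_generated_field_cong_AE:
  fixes \<phi> \<psi> :: "'w \<Rightarrow> real"
  assumes Z: "Z \<in> measurable M N" and \<phi>: "\<phi> \<in> borel_measurable (generated_field M Z N)"
    and \<psi>: "\<psi> \<in> borel_measurable M" and eq: "AE \<omega> in M. \<phi> \<omega> = \<psi> \<omega>"
  shows "\<psi> \<in> borel_measurable (generated_field M Z N)"
proof -
  let ?F = "generated_field M Z N"
  have \<phi>M: "\<phi> \<in> borel_measurable M"
    using measurable_from_subalg[OF subalgebra_generated_field[OF Z] \<phi>] .
  have null: "A \<in> sets ?F" if "A \<in> null_sets M" for A
    using that by (auto simp: sets_generated_field[OF Z])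
  define E where "E = {\<omega> \<in> space M. \<phi> \<omega> \<noteq> \<psi> \<omega>}"
  have E: "E \<in> null_sets M"
    unfolding E_def using eq \<phi>M \<psi> by (subst AE_iff_null_sets) (auto elim: AE_mp)
  show ?thesis
  proof (rule measurableI)
    fix A :: "real set" assume A: "A \<in> sets borel"
    have "\<psi> -` A \<inter> space M = (\<phi> -` A \<inter> space ?F - E) \<union> (\<psi> -` A \<inter> space M \<inter> E)"
      by (auto simp: E_def)
    moreover have "\<psi> -` A \<inter> space M \<inter> E \<in> null_sets M"
      using E \<psi> A by (intro null_set_Int1[OF E] measurable_sets)
    then have "\<psi> -` A \<inter> space M \<inter> E \<in> sets ?F" by (rule null)
    moreover have "\<phi> -` A \<inter> space ?F - E \<in> sets ?F"
      using measurable_sets[OF \<phi> A] null[OF E] by (rule sets.Diff)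
    ultimately show "\<psi> -` A \<inter> space ?F \<in> sets ?F"
      by (metis sets.Un space_generated_field)
  qed simp
qed

text \<open>Induction over the generated sigma-field: a null generator is matched by the empty set,
  and in the union case countably many exceptional null sets are combined.\<close>

lemma generated_field_set_factor:
  assumes Z: "Z \<in> measurable M N" and A: "A \<in> sets (generated_field M Z N)"
  shows "\<exists>B\<in>sets N. AE \<omega> in M. \<omega> \<in> A \<longleftrightarrow> Z \<omega> \<in> B"
  using A unfolding sets_generated_field[OF Z]
proof induction
  case (Basic a)
  then show ?case
  proof
    assume "a \<in> {Z -` A \<inter> space M | A. A \<in> sets N}"
    then obtain B where "B \<in> sets N" "a = Z -` B \<inter> space M" by blast
    then show ?thesis by (intro bexI[of _ B]) auto
  next
    assume "a \<in> null_sets M"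
    then have "AE \<omega> in M. \<omega> \<notin> a" by (rule AE_not_in)
    then show ?thesis by (intro bexI[of _ "{}"]) auto
  qed
next
  case Empty
  then show ?case by (intro bexI[of _ "{}"]) auto
next
  case (Compl a)
  then obtain B where B: "B \<in> sets N" "AE \<omega> in M. \<omega> \<in> a \<longleftrightarrow> Z \<omega> \<in> B" by blast
  have "AE \<omega> in M. \<omega> \<in> space M - a \<longleftrightarrow> Z \<omega> \<in> space N - B"
    using B(2) AE_space by eventually_elim (auto dest: measurable_space[OF Z])
  then show ?case using B(1) by blast
next
  case (Union a)
  then obtain B where B: "\<And>i. B i \<in> sets N" "\<And>i. AE \<omega> in M. \<omega> \<in> a i \<longleftrightarrow> Z \<omega> \<in> B i" by metis
  have "AE \<omega> in M. \<forall>i. \<omega> \<in> a i \<longleftrightarrow> Z \<omega> \<in> B i" using B(2) by (simp add: AE_all_countable)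
  then have "AE \<omega> in M. \<omega> \<in> (\<Union>i. a i) \<longleftrightarrow> Z \<omega> \<in> (\<Union>i. B i)" by eventually_elim auto
  with B(1) show ?case by (intro bexI[of _ "\<Union>i::nat. B i"]) auto
qed

text \<open>Doob-Dynkin factorization up to null sets, by monotone approximation starting from
  indicators.\<close>

lemma generated_field_nonneg_factor:
  fixes \<phi> :: "'w \<Rightarrow> real"
  assumes Z: "Z \<in> measurable M N"
    and \<phi>: "\<phi> \<in> borel_measurable (generated_field M Z N)" "\<And>\<omega>. 0 \<le> \<phi> \<omega>"
  shows "\<exists>\<psi>\<in>borel_measurable N. AE \<omega> in M. \<phi> \<omega> = \<psi> (Z \<omega>)"
  using \<phi>
proof (induction rule: borel_measurable_induct_real)
  case (set A)
  then obtain B where B: "B \<in> sets N" "AE \<omega> in M. \<omega> \<in> A \<longleftrightarrow> Z \<omega> \<in> B"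
    using generated_field_set_factor[OF Z] by blast
  from B(2) have "AE \<omega> in M. indicator A \<omega> = (indicator B (Z \<omega>) :: real)"
    by eventually_elim (auto simp: indicator_def)
  with B(1) show ?case by (intro bexI[of _ "indicator B"]) auto
next
  case (mult u c)
  then obtain \<psi> where \<psi>: "\<psi> \<in> borel_measurable N" "AE \<omega> in M. u \<omega> = \<psi> (Z \<omega>)" by blast
  then show ?case by (intro bexI[of _ "\<lambda>z. c * \<psi> z"]) auto
next
  case (add u v)
  then obtain \<psi> \<xi> where \<psi>: "\<psi> \<in> borel_measurable N" "AE \<omega> in M. u \<omega> = \<psi> (Z \<omega>)"
    and \<xi>: "\<xi> \<in> borel_measurable N" "AE \<omega> in M. v \<omega> = \<xi> (Z \<omega>)" by blast
  from \<psi>(2) \<xi>(2) have "AE \<omega> in M. v \<omega> + u \<omega> = \<xi> (Z \<omega>) + \<psi> (Z \<omega>)" by eventually_elim auto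
  with \<psi>(1) \<xi>(1) show ?case by (intro bexI[of _ "\<lambda>z. \<xi> z + \<psi> z"]) auto
next
  case (seq U)
  then obtain \<psi> where \<psi>: "\<And>i. \<psi> i \<in> borel_measurable N" "\<And>i. AE \<omega> in M. U i \<omega> = \<psi> i (Z \<omega>)"
    by metis
  have "AE \<omega> in M. \<forall>i. U i \<omega> = \<psi> i (Z \<omega>)" using \<psi>(2) by (simp add: AE_all_countable)
  with AE_space have "AE \<omega> in M. \<phi> \<omega> = lim (\<lambda>i. \<psi> i (Z \<omega>))"
  proof eventually_elim
    case (elim \<omega>)
    then have "(\<lambda>i. \<psi> i (Z \<omega>)) \<longlonglongrightarrow> \<phi> \<omega>" using seq.hyps(4)[of \<omega>] by simp
    then show ?case by (simp add: limI)
  qed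
  \<comment> \<open>\<open>lim\<close> has some value also where the sequence diverges, and the
    resulting function is still measurable, so no exceptional set has to be cut out of
    \<open>N\<close>.\<close>
  moreover have "(\<lambda>z. lim (\<lambda>i. \<psi> i z)) \<in> borel_measurable N"
    using \<psi>(1) by (intro borel_measurable_lim_metric)
  ultimately show ?case by (intro bexI[of _ "\<lambda>z. lim (\<lambda>i. \<psi> i z)"])
qed

text \<open>Positive and negative parts are factored separately. This turns variables measurable for
  the augmented field into honest functions of \<open>Z\<close>.\<close>

lemma generated_field_factor:
  fixes \<phi> :: "'w \<Rightarrow> real"
  assumes Z: "Z \<in> measurable M N" and \<phi>: "\<phi> \<in> borel_measurable (generated_field M Z N)"
  obtains \<psi> where "\<psi> \<in> borel_measurable N" "AE \<omega> in M. \<phi> \<omega> = \<psi> (Z \<omega>)"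
proof -
  have "(\<lambda>\<omega>. max 0 (\<phi> \<omega>)) \<in> borel_measurable (generated_field M Z N)"
    using \<phi> by (intro borel_measurable_max) auto
  from generated_field_nonneg_factor[OF Z this]
  obtain p where p: "p \<in> borel_measurable N" "AE \<omega> in M. max 0 (\<phi> \<omega>) = p (Z \<omega>)"
    by (auto simp only: max.cobounded1)
  have "(\<lambda>\<omega>. max 0 (- \<phi> \<omega>)) \<in> borel_measurable (generated_field M Z N)"
    using \<phi> by (intro borel_measurable_max) auto
  from generated_field_nonneg_factor[OF Z this]
  obtain q where q: "q \<in> borel_measurable N" "AE \<omega> in M. max 0 (- \<phi> \<omega>) = q (Z \<omega>)"
    by (auto simp only: max.cobounded1)
  from p(2) q(2) have "AE \<omega> in M. \<phi> \<omega> = p (Z \<omega>) - q (Z \<omega>)"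
    by eventually_elim (auto simp: max_def split: if_splits)
  with p(1) q(1) show ?thesis by (intro that[of "\<lambda>z. p z - q z"]) auto
qed

section \<open>Conditional expectation and conditional independence\<close>

text \<open>The assumption \<open>zero\<close> says that the conditional expectation of
  \<open>w\<close> given \<open>Z\<close> vanishes, and \<open>p (Z \<omega>)\<close> can be pulled
  out of it. This passes from indicators to general integrands without a further approximation
  argument.\<close>

lemma (in prob_space) integral_comp_mult_eq_0:
  fixes p :: "'b \<Rightarrow> real" and w :: "'a \<Rightarrow> real"
  assumes Z: "Z \<in> measurable M N" and w: "integrable M w"
    and zero: "\<And>B. B \<in> sets N \<Longrightarrow> (\<integral>\<omega>. indicator B (Z \<omega>) * w \<omega> \<partial>M) = 0"
    and p: "p \<in> borel_measurable N" "integrable M (\<lambda>\<omega>. p (Z \<omega>) * w \<omega>)"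
  shows "(\<integral>\<omega>. p (Z \<omega>) * w \<omega> \<partial>M) = 0"
proof -
  let ?F = "vimage_algebra (space M) Z N"
  have Zsp: "Z \<in> space M \<rightarrow> space N" using measurable_space[OF Z] by auto
  have "subalgebra M ?F"
    using Z by (auto simp: subalgebra_def sets_vimage_algebra2[OF Zsp] intro: measurable_sets)
  then interpret finite_measure_subalgebra M ?F by unfold_locales
  have "AE \<omega> in M. real_cond_exp M ?F w \<omega> = 0"
  proof (rule real_cond_exp_charact)
    fix A assume "A \<in> sets ?F"
    then obtain B where B: "B \<in> sets N" "A = Z -` B \<inter> space M"
      unfolding sets_vimage_algebra2[OF Zsp] by blast
    have "(\<integral>\<omega>\<in>A. w \<omega> \<partial>M) = (\<integral>\<omega>. indicator B (Z \<omega>) * w \<omega> \<partial>M)"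
      unfolding set_lebesgue_integral_def
      by (intro Bochner_Integration.integral_cong) (auto simp: B indicator_def)
    then show "(\<integral>\<omega>\<in>A. w \<omega> \<partial>M) = (\<integral>\<omega>\<in>A. 0 \<partial>M)"
      using zero[OF B(1)] by (simp add: set_lebesgue_integral_def)
  qed (use w in auto)
  then have "(\<integral>\<omega>. p (Z \<omega>) * real_cond_exp M ?F w \<omega> \<partial>M) = (\<integral>\<omega>. 0 \<partial>M)"
    by (intro integral_cong_AE) (use measurable_compose[OF Z p(1)] in auto)
  moreover have "(\<lambda>\<omega>. p (Z \<omega>)) \<in> borel_measurable ?F"
    by (rule measurable_compose[OF measurable_vimage_algebra1[OF Zsp] p(1)])
  ultimately show ?thesis using real_cond_exp_intg(2)[OF p(2)] w by simp
qed

lemma (in finite_measure_subalgebra) real_cond_exp_bounded: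
  assumes f: "f \<in> borel_measurable M" and C: "\<And>x. \<bar>f x\<bar> \<le> C"
  shows "integrable M f" "AE x in M. \<bar>real_cond_exp M F f x\<bar> \<le> C"
proof -
  show int: "integrable M f"
    by (rule integrable_const_bound[of _ C]) (use f C in auto)
  have "AE x in M. real_cond_exp M F f x \<le> C" "AE x in M. - C \<le> real_cond_exp M F f x"
    using C by (auto intro!: real_cond_exp_le_c real_cond_exp_ge_c int simp: abs_le_iff minus_le_iff)
  then show "AE x in M. \<bar>real_cond_exp M F f x\<bar> \<le> C" by eventually_elim auto
qed

lemma integrable_mult_AE_bounded:
  fixes f g :: "'w \<Rightarrow> real"
  assumes f: "integrable M f" and g: "g \<in> borel_measurable M" "AE x in M. \<bar>g x\<bar> \<le> C"
  shows "integrable M (\<lambda>x. f x * g x)"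
proof (rule Bochner_Integration.integrable_bound)
  show "integrable M (\<lambda>x. C * f x)" using f by simp
  show "AE x in M. norm (f x * g x) \<le> norm (C * f x)"
    using g(2)
  proof eventually_elim
    case (elim x)
    then have "\<bar>g x\<bar> * \<bar>f x\<bar> \<le> \<bar>C\<bar> * \<bar>f x\<bar>" by (intro mult_right_mono) auto
    then show ?case by (simp add: abs_mult mult.commute)
  qed
qed (use f g in auto)

text \<open>Tower property, then the product formula of conditional independence, then pulling out
  the \<open>F\<close>-measurable factor belonging to \<open>B\<close>.\<close>

lemma (in finite_measure_subalgebra) cond_independent_indicator:
  assumes ci: "cond_independent M F Y NY X NX"
    and X: "X \<in> measurable M NX" and Y: "Y \<in> measurable M NY"
    and A: "A \<in> sets NY" and B: "B \<in> sets NX"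
  shows "(\<integral>\<omega>. indicator A (Y \<omega>) * indicator B (X \<omega>) \<partial>M) =
    (\<integral>\<omega>. indicator A (Y \<omega>) * real_cond_exp M F (\<lambda>\<omega>. indicator B (X \<omega>)) \<omega> \<partial>M)"
proof -
  let ?a = "\<lambda>\<omega>. indicator A (Y \<omega>) :: real" and ?b = "\<lambda>\<omega>. indicator B (X \<omega>) :: real"
  have meas: "?a \<in> borel_measurable M" "?b \<in> borel_measurable M"
    by (rule measurable_compose[OF Y], use A in simp) (rule measurable_compose[OF X], use B in simp)
  note b = real_cond_exp_bounded[OF meas(2), of 1]
  have int: "integrable M ?a" "integrable M (\<lambda>\<omega>. ?a \<omega> * ?b \<omega>)"
    "integrable M (\<lambda>\<omega>. ?a \<omega> * real_cond_exp M F ?b \<omega>)"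
    using meas b by (auto intro!: integrable_mult_AE_bounded[where C=1] integrable_const_bound[where B=1]
        simp: indicator_def)
  have "(\<integral>\<omega>. ?a \<omega> * ?b \<omega> \<partial>M) = (\<integral>\<omega>. real_cond_exp M F (\<lambda>\<omega>. ?a \<omega> * ?b \<omega>) \<omega> \<partial>M)"
    by (rule real_cond_exp_int(2)[OF int(2), symmetric])
  also have "\<dots> = (\<integral>\<omega>. real_cond_exp M F ?b \<omega> * real_cond_exp M F ?a \<omega> \<partial>M)"
    using ci[unfolded cond_independent_def, rule_format, OF A B]
    by (intro integral_cong_AE) (auto simp: mult.commute)
  also have "\<dots> = (\<integral>\<omega>. real_cond_exp M F ?b \<omega> * ?a \<omega> \<partial>M)"
    using int(3) meas by (intro real_cond_exp_intg(2)) (auto simp: mult.commute)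
  finally show ?thesis by (simp add: mult.commute)
qed

text \<open>Two passes lead from indicators to functions: with \<open>B\<close> fixed, the indicator
  of \<open>A\<close> is replaced by \<open>a\<close>; afterwards the indicator of \<open>B\<close>
  is replaced by \<open>p\<close>. Boundedness of \<open>a\<close> keeps all products
  integrable.\<close>

lemma (in prob_space) cond_independent_integral:
  fixes a :: "'y \<Rightarrow> real" and p :: "'x \<Rightarrow> real"
  assumes F: "subalgebra M F" and ci: "cond_independent M F Y NY X NX"
    and X: "X \<in> measurable M NX" and Y: "Y \<in> measurable M NY"
    and a: "a \<in> borel_measurable NY" "\<And>y. \<bar>a y\<bar> \<le> C"
    and p: "p \<in> borel_measurable NX" "integrable M (\<lambda>\<omega>. p (X \<omega>))"
  shows "(\<integral>\<omega>. p (X \<omega>) * a (Y \<omega>) \<partial>M) =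
    (\<integral>\<omega>. p (X \<omega>) * real_cond_exp M F (\<lambda>\<omega>. a (Y \<omega>)) \<omega> \<partial>M)"
proof -
  interpret finite_measure_subalgebra M F using F by unfold_locales
  let ?w = "real_cond_exp M F (\<lambda>\<omega>. a (Y \<omega>))"
  have aY: "(\<lambda>\<omega>. a (Y \<omega>)) \<in> borel_measurable M" by (rule measurable_compose[OF Y a(1)])
  note w = real_cond_exp_bounded[OF aY a(2)]
  have B: "(\<integral>\<omega>. indicator B (X \<omega>) * (a (Y \<omega>) - ?w \<omega>) \<partial>M) = 0" if B: "B \<in> sets NX" for B
  proof -
    let ?b = "\<lambda>\<omega>. indicator B (X \<omega>) :: real" and ?v = "real_cond_exp M F (\<lambda>\<omega>. indicator B (X \<omega>))"
    have b: "?b \<in> borel_measurable M" by (rule measurable_compose[OF X]) (use B in simp)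
    note v = real_cond_exp_bounded[OF b, of 1]
    have vb: "AE \<omega> in M. \<bar>?v \<omega>\<bar> \<le> 1" "integrable M ?b" using v by (auto simp: indicator_def)
    have int: "integrable M (\<lambda>\<omega>. a (Y \<omega>) * ?b \<omega>)" "integrable M (\<lambda>\<omega>. a (Y \<omega>) * ?v \<omega>)"
      "integrable M (\<lambda>\<omega>. ?b \<omega> * ?w \<omega>)"
      using w vb b
      by (auto intro: integrable_mult_AE_bounded[where C=1] integrable_mult_AE_bounded[where C=C]
          simp: indicator_def)
    have "(\<integral>\<omega>. a (Y \<omega>) * (?b \<omega> - ?v \<omega>) \<partial>M) = 0"
    proof (rule integral_comp_mult_eq_0[OF Y _ _ a(1)])
      fix A assume A: "A \<in> sets NY"
      have ia: "(\<lambda>\<omega>. indicator A (Y \<omega>) :: real) \<in> borel_measurable M"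
        by (rule measurable_compose[OF Y]) (use A in simp)
      have "integrable M (\<lambda>\<omega>. indicator A (Y \<omega>) :: real)"
        by (rule integrable_const_bound[of _ 1]) (use ia in auto)
      then have "integrable M (\<lambda>\<omega>. indicator A (Y \<omega>) * ?b \<omega>)"
        "integrable M (\<lambda>\<omega>. indicator A (Y \<omega>) * ?v \<omega>)"
        using vb b by (auto intro: integrable_mult_AE_bounded[where C=1] simp: indicator_def)
      then show "(\<integral>\<omega>. indicator A (Y \<omega>) * (?b \<omega> - ?v \<omega>) \<partial>M) = 0"
        using cond_independent_indicator[OF ci X Y A B] by (simp add: right_diff_distrib)
    qed (use vb int in \<open>auto simp: right_diff_distrib\<close>)
    then have "(\<integral>\<omega>. a (Y \<omega>) * ?b \<omega> \<partial>M) = (\<integral>\<omega>. a (Y \<omega>) * ?v \<omega> \<partial>M)"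
      using int by (simp add: right_diff_distrib)
    \<comment> \<open>Self-adjointness of conditional expectation: the integral of the product of
      both conditional expectations is the intermediate value through which the conditioning moves
      from the indicator of \<open>B\<close> to \<open>a\<close>.\<close>
    also have "\<dots> = (\<integral>\<omega>. ?v \<omega> * ?w \<omega> \<partial>M)"
      using int aY by (subst real_cond_exp_intg(2)) (auto simp: mult.commute)
    also have "\<dots> = (\<integral>\<omega>. ?b \<omega> * ?w \<omega> \<partial>M)"
      using real_cond_exp_intg(2)[of ?w ?b] int b by (simp add: mult.commute)
    finally show ?thesis using int by (simp add: right_diff_distrib mult.commute)
  qed
  have int: "integrable M (\<lambda>\<omega>. p (X \<omega>) * a (Y \<omega>))" "integrable M (\<lambda>\<omega>. p (X \<omega>) * ?w \<omega>)"
    using w p aY a(2) by (auto intro: integrable_mult_AE_bounded[where C=C])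
  have "(\<integral>\<omega>. p (X \<omega>) * (a (Y \<omega>) - ?w \<omega>) \<partial>M) = 0"
    by (rule integral_comp_mult_eq_0[OF X _ B p(1)])
       (use w int in \<open>auto simp: right_diff_distrib\<close>)
  then show ?thesis using int by (simp add: right_diff_distrib)
qed

section \<open>Integration over independent random elements\<close>

text \<open>The joint law is the product of the marginal laws, so Fubini applies to the laws and is
  transported back to \<open>M\<close>. The third claim is measurability on \<open>N\<close> itself
  rather than up to a null set, which later permits restriction to a fixed slice.\<close>

lemma (in prob_space) indep_var_fubini:
  fixes c :: "'b \<times> 'b \<Rightarrow> real"
  assumes ind: "indep_var N Z N' Z'" and c: "c \<in> borel_measurable (N \<Otimes>\<^sub>M N')"
    and int: "integrable M (\<lambda>\<omega>. c (Z \<omega>, Z' \<omega>))"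
  shows "(\<integral>\<omega>. c (Z \<omega>, Z' \<omega>) \<partial>M) = (\<integral>\<omega>. (\<integral>\<omega>'. c (Z \<omega>, Z' \<omega>') \<partial>M) \<partial>M)"
    and "AE z in distr M N Z. integrable M (\<lambda>\<omega>'. c (z, Z' \<omega>'))"
    and "(\<lambda>z. \<integral>\<omega>'. c (z, Z' \<omega>') \<partial>M) \<in> borel_measurable N"
proof -
  have Z: "Z \<in> measurable M N" "Z' \<in> measurable M N'"
    and eq: "distr M N Z \<Otimes>\<^sub>M distr M N' Z' = distr M (N \<Otimes>\<^sub>M N') (\<lambda>\<omega>. (Z \<omega>, Z' \<omega>))"
    using ind unfolding indep_var_distribution_eq by auto
  have ZZ: "(\<lambda>\<omega>. (Z \<omega>, Z' \<omega>)) \<in> measurable M (N \<Otimes>\<^sub>M N')" using Z by simp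
  interpret P: prob_space "distr M N Z" by (rule prob_space_distr[OF Z(1)])
  interpret P': prob_space "distr M N' Z'" by (rule prob_space_distr[OF Z(2)])
  interpret PP: pair_sigma_finite "distr M N Z" "distr M N' Z'" ..
  have intd: "integrable (distr M N Z \<Otimes>\<^sub>M distr M N' Z') c"
    unfolding eq using int by (simp add: integrable_distr_eq[OF ZZ c])
  have sec: "(\<lambda>z'. c (z, z')) \<in> borel_measurable N'" if "z \<in> space N" for z
    using c that by simp
  have inner: "(\<integral>\<omega>'. c (z, Z' \<omega>') \<partial>M) = (\<integral>z'. c (z, z') \<partial>distr M N' Z')" if "z \<in> space N" for z
    by (rule integral_distr[OF Z(2) sec[OF that], symmetric])
  have "(\<lambda>z. \<integral>z'. c (z, z') \<partial>distr M N' Z') \<in> borel_measurable N"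
    using c by (intro P'.borel_measurable_lebesgue_integral) (simp add: case_prod_beta' cong: measurable_cong_sets)
  then show meas: "(\<lambda>z. \<integral>\<omega>'. c (z, Z' \<omega>') \<partial>M) \<in> borel_measurable N"
    by (subst measurable_cong[OF inner]) auto
  have "(\<integral>\<omega>. c (Z \<omega>, Z' \<omega>) \<partial>M) = (\<integral>z. c z \<partial>(distr M N Z \<Otimes>\<^sub>M distr M N' Z'))"
    unfolding eq by (rule integral_distr[OF ZZ c, symmetric])
  also have "\<dots> = (\<integral>z. (\<integral>z'. c (z, z') \<partial>distr M N' Z') \<partial>distr M N Z)"
    by (rule PP.integral_fst'[OF intd, symmetric])
  also have "\<dots> = (\<integral>z. (\<integral>\<omega>'. c (z, Z' \<omega>') \<partial>M) \<partial>distr M N Z)"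
    by (intro Bochner_Integration.integral_cong) (auto simp: inner)
  also have "\<dots> = (\<integral>\<omega>. (\<integral>\<omega>'. c (Z \<omega>, Z' \<omega>') \<partial>M) \<partial>M)"
    by (rule integral_distr[OF Z(1) meas])
  finally show "(\<integral>\<omega>. c (Z \<omega>, Z' \<omega>) \<partial>M) = (\<integral>\<omega>. (\<integral>\<omega>'. c (Z \<omega>, Z' \<omega>') \<partial>M) \<partial>M)" .
  show "AE z in distr M N Z. integrable M (\<lambda>\<omega>'. c (z, Z' \<omega>'))"
    using PP.AE_integrable_fst'[OF intd] AE_space
  proof eventually_elim
    case (elim z)
    then show ?case by (intro integrable_distr[OF Z(2)])
  qed
qed

text \<open>By Fubini, \<open>p z * q (Z' \<omega>)\<close> is integrable in \<open>\<omega>\<close>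
  for almost every \<open>z\<close>. Were \<open>q (Z' \<omega>)\<close> not integrable, this would
  force \<open>p z = 0\<close> for all those \<open>z\<close>.\<close>

lemma (in prob_space) indep_var_integrable_factor:
  fixes p :: "'b \<Rightarrow> real" and q :: "'b \<Rightarrow> real"
  assumes ind: "indep_var N Z N' Z'" and p: "p \<in> borel_measurable N" and q: "q \<in> borel_measurable N'"
    and int: "integrable M (\<lambda>\<omega>. p (Z \<omega>) * q (Z' \<omega>))"
    and nz: "\<not> (AE \<omega> in M. p (Z \<omega>) = 0)"
  shows "integrable M (\<lambda>\<omega>. q (Z' \<omega>))"
proof (rule ccontr)
  assume n: "\<not> integrable M (\<lambda>\<omega>. q (Z' \<omega>))"
  have Z: "Z \<in> measurable M N" using ind unfolding indep_var_distribution_eq by auto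
  have "AE z in distr M N Z. integrable M (\<lambda>\<omega>'. p z * q (Z' \<omega>'))"
    using indep_var_fubini(2)[OF ind, of "\<lambda>(z, z'). p z * q z'"] p q int by simp
  then have "AE z in distr M N Z. p z = 0"
    by eventually_elim (use n in auto)
  then show False using nz p by (simp add: AE_distr_iff[OF Z])
qed

lemma (in prob_space) indep_var_comp_integrals:
  fixes p q :: "'b \<Rightarrow> real"
  assumes ind: "indep_var N Z N Z'" and p: "p \<in> borel_measurable N" and q: "q \<in> borel_measurable N"
    and int: "integrable M (\<lambda>\<omega>. p (Z \<omega>))" "integrable M (\<lambda>\<omega>. q (Z' \<omega>))"
  shows "integrable M (\<lambda>\<omega>. p (Z \<omega>) * q (Z' \<omega>))"
    and "(\<integral>\<omega>. p (Z \<omega>) * q (Z' \<omega>) \<partial>M) = (\<integral>\<omega>. p (Z \<omega>) \<partial>M) * (\<integral>\<omega>. q (Z' \<omega>) \<partial>M)"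
proof -
  have "indep_var borel (\<lambda>\<omega>. p (Z \<omega>)) borel (\<lambda>\<omega>. q (Z' \<omega>))"
    using indep_var_compose[OF ind p q] by (simp add: comp_def)
  then show "integrable M (\<lambda>\<omega>. p (Z \<omega>) * q (Z' \<omega>))"
    and "(\<integral>\<omega>. p (Z \<omega>) * q (Z' \<omega>) \<partial>M) = (\<integral>\<omega>. p (Z \<omega>) \<partial>M) * (\<integral>\<omega>. q (Z' \<omega>) \<partial>M)"
    using int by (rule indep_var_integrable, rule indep_var_lebesgue_integral)
qed

section \<open>Moments and covariances of elements of the Hilbert space\<close>

locale rkhs_random_element = prob_space M
  for M :: "'w measure" +
  fixes X :: "'w \<Rightarrow> 'x::topological_space" and \<kappa> :: "'x \<Rightarrow> 'x \<Rightarrow> real"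
    and val :: "'h::{real_inner,complete_space} \<Rightarrow> 'x \<Rightarrow> real"
  assumes meas_X: "X \<in> borel_measurable M"
    and rkhs: "is_rkhs val \<kappa>"
    and meas_kernel: "\<And>x. (\<lambda>y. \<kappa> y x) \<in> borel_measurable borel"
    and integrable_diag: "integrable M (\<lambda>\<omega>. \<kappa> (X \<omega>) (X \<omega>))"
begin

abbreviation k where "k \<equiv> kernel_section val \<kappa>"

abbreviation \<mu> where "\<mu> \<equiv> mean_element M k X"

text \<open>By the reproducing property this is the function belonging to \<open>h\<close> minus its
  mean under \<open>X\<close>; the inner-product form matches the tensors in the two
  operators.\<close>

definition centered :: "'h \<Rightarrow> 'x \<Rightarrow> real" where
  "centered h x = h \<bullet> (k x - \<mu>)"

lemma inner_kernel_section_measurable [measurable]: "(\<lambda>x. h \<bullet> k x) \<in> borel_measurable borel"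
  using rkhs_val_measurable[OF rkhs meas_kernel, of h] by (simp flip: rkhs_val_eq[OF rkhs])

lemma inner_kernel_section_measurable_X [measurable]: "(\<lambda>\<omega>. h \<bullet> k (X \<omega>)) \<in> borel_measurable M"
  by (rule measurable_compose[OF meas_X]) simp

lemma centered_measurable: "centered h \<in> borel_measurable borel"
  and centered_measurable_X: "(\<lambda>\<omega>. centered h (X \<omega>)) \<in> borel_measurable M"
  unfolding centered_def inner_diff_right by measurable

text \<open>Cauchy-Schwarz for each factor, with \<open>\<kappa> x x\<close> as the squared norm of
  \<open>k x\<close>. Integrability of the kernel diagonal thereby gives every element a finite
  second moment under \<open>X\<close>.\<close>

lemma abs_inner_mult_le: "\<bar>(g \<bullet> k x) * (h \<bullet> k x)\<bar> \<le> norm g * norm h * \<kappa> x x"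
proof -
  have "\<bar>g \<bullet> k x\<bar> * \<bar>h \<bullet> k x\<bar> \<le> (norm g * norm (k x)) * (norm h * norm (k x))"
    by (intro mult_mono Cauchy_Schwarz_ineq2) auto
  also have "\<dots> = norm g * norm h * \<kappa> x x"
    unfolding rkhs_norm_kernel_section[OF rkhs, symmetric] by (simp add: power2_eq_square)
  finally show ?thesis by (simp add: abs_mult)
qed

lemma integrable_inner_mult: "integrable M (\<lambda>\<omega>. (g \<bullet> k (X \<omega>)) * (h \<bullet> k (X \<omega>)))"
proof (rule Bochner_Integration.integrable_bound)
  show "integrable M (\<lambda>\<omega>. norm g * norm h * \<kappa> (X \<omega>) (X \<omega>))" using integrable_diag by simp
  show "AE \<omega> in M. norm ((g \<bullet> k (X \<omega>)) * (h \<bullet> k (X \<omega>))) \<le> norm (norm g * norm h * \<kappa> (X \<omega>) (X \<omega>))"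
    unfolding real_norm_def
    by (intro always_eventually allI order_trans[OF abs_inner_mult_le abs_ge_self])
qed measurable

lemma integrable_inner: "integrable M (\<lambda>\<omega>. h \<bullet> k (X \<omega>))"
proof (rule square_integrable_imp_integrable)
  show "integrable M (\<lambda>\<omega>. (h \<bullet> k (X \<omega>))\<^sup>2)"
    unfolding power2_eq_square by (rule integrable_inner_mult)
qed measurable

lemma integrable_one_plus_diag: "integrable M (\<lambda>\<omega>. 1 + \<kappa> (X \<omega>) (X \<omega>))"
  using integrable_diag by simp

lemma inner_mean_element: "h \<bullet> \<mu> = (\<integral>\<omega>. h \<bullet> k (X \<omega>) \<partial>M)"
  unfolding mean_element_def
proof (rule inner_expect_weakly_integrable, rule weakly_integrableI)
  show "\<bar>f \<bullet> k (X \<omega>)\<bar> \<le> norm f * (1 + \<kappa> (X \<omega>) (X \<omega>))" for f \<omega>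
  proof -
    \<comment> \<open>The estimate \<open>t \<le> 1 + t\<^sup>2\<close> dominates the norm by an
      integrable function of the kernel diagonal, with no square root.\<close>
    have "norm (k (X \<omega>)) \<le> 1 + (norm (k (X \<omega>)))\<^sup>2"
      using zero_le_power2[of "norm (k (X \<omega>)) - 1"] zero_le_power2[of "norm (k (X \<omega>))"]
      norm_ge_zero[of "k (X \<omega>)"]
      unfolding power2_diff one_power2 by argo
    then have "norm f * norm (k (X \<omega>)) \<le> norm f * (1 + \<kappa> (X \<omega>) (X \<omega>))"
      unfolding rkhs_norm_kernel_section[OF rkhs] by (rule mult_left_mono) simp
    then show ?thesis using Cauchy_Schwarz_ineq2[of f "k (X \<omega>)"] by linarith
  qed
qed (rule integrable_inner integrable_one_plus_diag)+

lemma centered_eq: "centered h x = val h x - (\<integral>\<omega>. h \<bullet> k (X \<omega>) \<partial>M)"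
  unfolding centered_def by (simp only: inner_diff_right inner_mean_element rkhs_val_eq[OF rkhs, of h x])

lemma integrable_centered: "integrable M (\<lambda>\<omega>. centered h (X \<omega>))"
  unfolding centered_def inner_diff_right using integrable_inner by simp

lemma integral_centered: "(\<integral>\<omega>. centered h (X \<omega>) \<partial>M) = 0"
  unfolding centered_def inner_diff_right using integrable_inner
  by (simp add: inner_mean_element prob_space)

lemma integrable_centered_mult: "integrable M (\<lambda>\<omega>. centered g (X \<omega>) * centered h (X \<omega>))"
  unfolding centered_def inner_diff_right left_diff_distrib right_diff_distrib
  using integrable_inner integrable_inner_mult by simp

text \<open>Expanding the product of the centered values gives the mixed second moment minus the
  product of the means, which are the contributions of the two tensors.\<close>

lemma inner_cov_op: "h \<bullet> cov_op M k X g = (\<integral>\<omega>. centered h (X \<omega>) * centered g (X \<omega>) \<partial>M)"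
proof -
  let ?T = "\<lambda>\<omega>. tensor (k (X \<omega>)) (k (X \<omega>)) g"
  have T: "f \<bullet> ?T \<omega> = (g \<bullet> k (X \<omega>)) * (f \<bullet> k (X \<omega>))" for f \<omega>
    by (simp add: tensor_def inner_commute)
  have "weakly_integrable M ?T"
  proof (rule weakly_integrableI)
    show "\<bar>f \<bullet> ?T \<omega>\<bar> \<le> norm f * (norm g * \<kappa> (X \<omega>) (X \<omega>))" for f \<omega>
      unfolding T using abs_inner_mult_le[of g "X \<omega>" f] by (simp add: algebra_simps)
  qed (use integrable_diag integrable_inner_mult in \<open>simp_all add: T\<close>)
  then have "h \<bullet> expect M ?T = (\<integral>\<omega>. (g \<bullet> k (X \<omega>)) * (h \<bullet> k (X \<omega>)) \<partial>M)"
    by (simp add: inner_expect_weakly_integrable T)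
  then have "h \<bullet> cov_op M k X g =
      (\<integral>\<omega>. (g \<bullet> k (X \<omega>)) * (h \<bullet> k (X \<omega>)) \<partial>M) - (g \<bullet> \<mu>) * (h \<bullet> \<mu>)"
    by (simp add: cov_op_def expect_op_def tensor_def inner_diff_right inner_commute)
  also have "\<dots> = (\<integral>\<omega>. centered h (X \<omega>) * centered g (X \<omega>) \<partial>M)"
    unfolding centered_def inner_diff_right left_diff_distrib right_diff_distrib
    using integrable_inner integrable_inner_mult
    by (simp add: inner_mean_element[symmetric] prob_space algebra_simps)
  finally show ?thesis .
qed

lemma inner_wire_op:
  assumes "weakly_integrable M (\<lambda>\<omega>. wire_integrand M k X Y X' Y' \<omega> g)"
  shows "integrable M (\<lambda>\<omega>. dist (Y \<omega>) (Y' \<omega>) * (centered h (X \<omega>) * centered g (X' \<omega>)))"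
    and "h \<bullet> wire_op M k X Y X' Y' g =
      - (\<integral>\<omega>. dist (Y \<omega>) (Y' \<omega>) * (centered h (X \<omega>) * centered g (X' \<omega>)) \<partial>M)"
proof -
  have eq: "h \<bullet> wire_integrand M k X Y X' Y' \<omega> g =
      dist (Y \<omega>) (Y' \<omega>) * (centered h (X \<omega>) * centered g (X' \<omega>))" for h \<omega>
    unfolding wire_integrand_def tensor_def centered_def
    by (simp add: inner_commute mult.commute)
  show "integrable M (\<lambda>\<omega>. dist (Y \<omega>) (Y' \<omega>) * (centered h (X \<omega>) * centered g (X' \<omega>)))"
    using assms unfolding weakly_integrable_def eq by blast
  show "h \<bullet> wire_op M k X Y X' Y' g =
      - (\<integral>\<omega>. dist (Y \<omega>) (Y' \<omega>) * (centered h (X \<omega>) * centered g (X' \<omega>)) \<partial>M)"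
    using inner_expect_weakly_integrable[OF assms, of h]
    by (simp only: wire_op_def expect_op_def inner_minus_right eq)
qed

section \<open>Membership in the central class by an orthogonality argument\<close>

text \<open>The residual \<open>r\<close>, the sum of centered \<open>u (X)\<close> and centered
  \<open>w\<close>, is orthogonal to all centered elements by \<open>cov\<close>. Density extends
  this to the part coming from \<open>w\<close>, so \<open>r\<close> is orthogonal to itself and
  \<open>u (X)\<close> inherits measurability from \<open>w\<close>.\<close>

lemma central_class_if_cov_bounded:
  fixes f :: "'x \<Rightarrow> 'z::topological_space"
  defines "F \<equiv> generated_field M (\<lambda>\<omega>. f (X \<omega>)) borel"
  assumes f: "f \<in> borel_measurable borel"
    and dense: "L2_dense_in (distr M borel X) (val ` central_class val X F) (L2_measurable_functions M X F)"
    and w: "w \<in> borel_measurable F" "AE \<omega> in M. \<bar>w \<omega>\<bar> \<le> C"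
    and cov: "\<And>h. (\<integral>\<omega>. centered h (X \<omega>) * centered u (X \<omega>) \<partial>M) = - (\<integral>\<omega>. centered h (X \<omega>) * w \<omega> \<partial>M)"
  shows "u \<in> central_class val X F"
proof -
  have fX: "(\<lambda>\<omega>. f (X \<omega>)) \<in> borel_measurable M" by (rule measurable_compose[OF meas_X f])
  have wM: "w \<in> borel_measurable M"
    using measurable_from_subalg[OF subalgebra_generated_field[OF fX]] w(1) unfolding F_def by blast
  have int_w: "integrable M w" using w(2) wM by (intro integrable_const_bound[of _ C]) auto
  define e where "e = (\<integral>\<omega>. w \<omega> \<partial>M)"
  \<comment> \<open>The density hypothesis speaks of functions of \<open>X\<close>, so
    \<open>w\<close> is first written as a function of \<open>f (X \<omega>)\<close>; subtracting
    the mean \<open>e\<close> then gives \<phi>.\<close>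
  obtain \<psi> where \<psi>: "\<psi> \<in> borel_measurable borel" "AE \<omega> in M. w \<omega> = \<psi> (f (X \<omega>))"
    using generated_field_factor[OF fX w(1)[unfolded F_def]] by blast
  define \<phi> where "\<phi> x = \<psi> (f x) - e" for x
  have \<phi>: "\<phi> \<in> borel_measurable borel"
    unfolding \<phi>_def using measurable_compose[OF f \<psi>(1)] by simp
  have \<phi>X: "(\<lambda>\<omega>. \<phi> (X \<omega>)) \<in> borel_measurable M" by (rule measurable_compose[OF meas_X \<phi>])
  have \<phi>w: "AE \<omega> in M. \<phi> (X \<omega>) = w \<omega> - e" using \<psi>(2) by eventually_elim (simp add: \<phi>_def)
  have \<phi>F: "(\<lambda>\<omega>. \<phi> (X \<omega>)) \<in> borel_measurable F"
    unfolding F_def \<phi>_def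
    using measurable_generated_field_comp[OF fX \<psi>(1)] by simp
  have \<phi>_bound: "AE \<omega> in M. \<bar>\<phi> (X \<omega>)\<bar> \<le> C + \<bar>e\<bar>"
    using w(2) \<phi>w by eventually_elim auto
  have int_\<phi>: "integrable M (\<lambda>\<omega>. \<phi> (X \<omega>))"
    using \<phi>_bound \<phi>X by (intro integrable_const_bound[of _ "C + \<bar>e\<bar>"]) auto
  have int_\<phi>2: "integrable M (\<lambda>\<omega>. \<phi> (X \<omega>) * \<phi> (X \<omega>))"
    by (rule integrable_mult_AE_bounded[OF int_\<phi> \<phi>X \<phi>_bound])
  have int_c\<phi>: "integrable M (\<lambda>\<omega>. centered h (X \<omega>) * \<phi> (X \<omega>))" for h
    by (rule integrable_mult_AE_bounded[OF integrable_centered \<phi>X \<phi>_bound])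
  have integral_\<phi>: "(\<integral>\<omega>. \<phi> (X \<omega>) \<partial>M) = 0"
  proof -
    have "(\<integral>\<omega>. \<phi> (X \<omega>) \<partial>M) = (\<integral>\<omega>. w \<omega> - e \<partial>M)"
      using \<phi>w \<phi>X wM by (intro integral_cong_AE) auto
    then show ?thesis using int_w by (simp add: e_def prob_space)
  qed
  have c\<phi>: "(\<integral>\<omega>. centered h (X \<omega>) * \<phi> (X \<omega>) \<partial>M) = (\<integral>\<omega>. centered h (X \<omega>) * w \<omega> \<partial>M)" for h
  proof -
    have int: "integrable M (\<lambda>\<omega>. centered h (X \<omega>) * w \<omega>)"
      by (rule integrable_mult_AE_bounded[OF integrable_centered wM w(2)])
    have "(\<integral>\<omega>. centered h (X \<omega>) * \<phi> (X \<omega>) \<partial>M) =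
        (\<integral>\<omega>. centered h (X \<omega>) * w \<omega> - e * centered h (X \<omega>) \<partial>M)"
    proof (rule integral_cong_AE)
      show "AE \<omega> in M. centered h (X \<omega>) * \<phi> (X \<omega>) = centered h (X \<omega>) * w \<omega> - e * centered h (X \<omega>)"
        using \<phi>w by eventually_elim (simp add: left_diff_distrib mult.commute)
    qed (use \<phi>X wM centered_measurable_X[of h] in auto)
    then show ?thesis using int integrable_centered by (simp add: integral_centered)
  qed
  define r where "r \<omega> = centered u (X \<omega>) + \<phi> (X \<omega>)" for \<omega>
  have int_r: "integrable M r" unfolding r_def using integrable_centered int_\<phi> by simp
  have integral_r: "(\<integral>\<omega>. r \<omega> \<partial>M) = 0"
    unfolding r_def using integrable_centered int_\<phi> by (simp add: integral_centered integral_\<phi>)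
  have int_cr: "integrable M (\<lambda>\<omega>. centered h (X \<omega>) * r \<omega>)" for h
    unfolding r_def using integrable_centered_mult int_c\<phi> by (simp add: distrib_left)
  have cr: "(\<integral>\<omega>. centered h (X \<omega>) * r \<omega> \<partial>M) = 0" for h
    unfolding r_def using integrable_centered_mult int_c\<phi> by (simp add: distrib_left cov c\<phi>)
  have int_\<phi>r: "integrable M (\<lambda>\<omega>. \<phi> (X \<omega>) * r \<omega>)"
    using integrable_mult_AE_bounded[OF int_r \<phi>X \<phi>_bound] by (simp add: mult.commute)
  have int_r2: "integrable M (\<lambda>\<omega>. (r \<omega>)\<^sup>2)"
  proof -
    have "(\<lambda>\<omega>. (r \<omega>)\<^sup>2) = (\<lambda>\<omega>. centered u (X \<omega>) * r \<omega> + \<phi> (X \<omega>) * r \<omega>)"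
      by (simp add: r_def fun_eq_iff power2_eq_square algebra_simps)
    then show ?thesis using int_cr int_\<phi>r by simp
  qed
  have \<phi>_L2: "\<phi> \<in> L2_measurable_functions M X F"
    using \<phi> \<phi>F int_\<phi>2
    by (simp add: L2_measurable_functions_def L2_functions_def integrable_distr_eq[OF meas_X] power2_eq_square)
  \<comment> \<open>An element \<open>h\<close> of the central class approximates \<phi> in the mean
    square, with error \<open>d\<close>. As \<open>r\<close> is orthogonal to centered elements and
    to constants, only \<open>d \<omega> * r \<omega>\<close> survives when
    \<open>(r \<omega>)\<^sup>2\<close> is expanded and integrated.\<close>
  have small: "(\<integral>\<omega>. (r \<omega>)\<^sup>2 \<partial>M) \<le> \<epsilon>\<^sup>2" if "0 < \<epsilon>" for \<epsilon>
  proof -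
    obtain h where h: "sqrt (\<integral>x. (\<phi> x - val h x)\<^sup>2 \<partial>distr M borel X) < \<epsilon>"
      using dense \<phi>_L2 \<open>0 < \<epsilon>\<close> unfolding L2_dense_in_def by blast
    define c where "c = (\<integral>\<omega>. h \<bullet> k (X \<omega>) \<partial>M)"
    have val_h: "val h x = centered h x + c" for x by (simp add: centered_eq c_def)
    define d where "d \<omega> = \<phi> (X \<omega>) - (centered h (X \<omega>) + c)" for \<omega>
    have d2: "(d \<omega>)\<^sup>2 = \<phi> (X \<omega>) * \<phi> (X \<omega>) + centered h (X \<omega>) * centered h (X \<omega>) + c\<^sup>2
        - 2 * (centered h (X \<omega>) * \<phi> (X \<omega>)) - 2 * c * \<phi> (X \<omega>) + 2 * c * centered h (X \<omega>)" for \<omega>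
      by (simp add: d_def power2_eq_square algebra_simps)
    have int_d2: "integrable M (\<lambda>\<omega>. (d \<omega>)\<^sup>2)"
      unfolding d2 using int_\<phi> int_\<phi>2 integrable_centered integrable_centered_mult int_c\<phi> by simp
    have "(\<integral>x. (\<phi> x - val h x)\<^sup>2 \<partial>distr M borel X) = (\<integral>\<omega>. (d \<omega>)\<^sup>2 \<partial>M)"
      unfolding d_def val_h using \<phi> centered_measurable[of h]
      by (intro integral_distr[OF meas_X]) simp
    with h have "sqrt (\<integral>\<omega>. (d \<omega>)\<^sup>2 \<partial>M) < \<epsilon>" by simp
    then have d_small: "(\<integral>\<omega>. (d \<omega>)\<^sup>2 \<partial>M) \<le> \<epsilon>\<^sup>2"
      using \<open>0 < \<epsilon>\<close> by (auto dest!: less_imp_le intro: sqrt_le_D)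
    have "(r \<omega>)\<^sup>2 = centered u (X \<omega>) * r \<omega> + centered h (X \<omega>) * r \<omega> + c * r \<omega> + d \<omega> * r \<omega>" for \<omega>
      by (simp add: d_def r_def power2_eq_square algebra_simps)
    moreover have "integrable M (\<lambda>\<omega>. d \<omega> * r \<omega>)"
      unfolding d_def using int_\<phi>r int_cr[of h] int_r by (simp add: left_diff_distrib distrib_right)
    ultimately have "(\<integral>\<omega>. (r \<omega>)\<^sup>2 \<partial>M) = (\<integral>\<omega>. d \<omega> * r \<omega> \<partial>M)"
      using int_cr int_r by (simp add: cr integral_r)
    \<comment> \<open>Young's inequality; the half of the integral of
      \<open>(r \<omega>)\<^sup>2\<close> on the right is absorbed into the left-hand side.\<close>
    also have "\<dots> \<le> (\<integral>\<omega>. (d \<omega>)\<^sup>2 / 2 + (r \<omega>)\<^sup>2 / 2 \<partial>M)"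
    proof (rule integral_mono)
      show "d \<omega> * r \<omega> \<le> (d \<omega>)\<^sup>2 / 2 + (r \<omega>)\<^sup>2 / 2" for \<omega>
        using sum_squares_bound[of "d \<omega>" "r \<omega>"] by simp
    qed (use \<open>integrable M (\<lambda>\<omega>. d \<omega> * r \<omega>)\<close> int_d2 int_r2 in auto)
    also have "\<dots> = (\<integral>\<omega>. (d \<omega>)\<^sup>2 \<partial>M) / 2 + (\<integral>\<omega>. (r \<omega>)\<^sup>2 \<partial>M) / 2"
      using int_d2 int_r2 by simp
    finally show ?thesis using d_small by argo
  qed
  have "(\<integral>\<omega>. (r \<omega>)\<^sup>2 \<partial>M) \<le> 0"
  proof (rule field_le_epsilon)
    fix \<epsilon> :: real assume "0 < \<epsilon>"
    then show "(\<integral>\<omega>. (r \<omega>)\<^sup>2 \<partial>M) \<le> 0 + \<epsilon>" using small[of "sqrt \<epsilon>"] by simp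
  qed
  then have "(\<integral>\<omega>. (r \<omega>)\<^sup>2 \<partial>M) = 0" by (intro antisym integral_nonneg_AE) auto
  then have "AE \<omega> in M. (r \<omega>)\<^sup>2 = 0" by (subst (asm) integral_nonneg_eq_0_iff_AE[OF int_r2]) auto
  \<comment> \<open>Where \<open>r\<close> vanishes, \<open>val u (X \<omega>)\<close> is a constant
    minus \<open>\<phi> (X \<omega>)\<close>. Almost sure equality suffices because \<open>F\<close>
    contains the null events.\<close>
  then have "AE \<omega> in M. (\<integral>\<omega>. u \<bullet> k (X \<omega>) \<partial>M) - \<phi> (X \<omega>) = val u (X \<omega>)"
    by eventually_elim (simp add: r_def centered_eq)
  moreover have "(\<lambda>\<omega>. val u (X \<omega>)) \<in> borel_measurable M"
    by (rule measurable_compose[OF meas_X rkhs_val_measurable[OF rkhs meas_kernel]])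
  moreover have "(\<lambda>\<omega>. (\<integral>\<omega>. u \<bullet> k (X \<omega>) \<partial>M) - \<phi> (X \<omega>)) \<in> borel_measurable F"
    using \<phi>F by simp
  ultimately have "(\<lambda>\<omega>. val u (X \<omega>)) \<in> borel_measurable F"
    using measurable_generated_field_cong_AE[OF fX] unfolding F_def by blast
  then show ?thesis unfolding central_class_def by (rule CollectI)
qed

end

section \<open>Independent copies and the distance weight\<close>

text \<open>In a non-separable metric space the distance need not be measurable for the product of
  the Borel sigma-fields, so \<open>meas_dist\<close> asks for this only along the pair
  \<open>(Y, Y')\<close> and up to null events. \<open>wire_integrable\<close> is the scalar
  integrability that the well-definedness of the ensemble operator yields.\<close>

locale rkhs_copies = rkhs_random_element M X \<kappa> val
  for M :: "'w measure" and X :: "'w \<Rightarrow> 'x::topological_space" and \<kappa>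
    and val :: "'h::{real_inner,complete_space} \<Rightarrow> 'x \<Rightarrow> real" +
  fixes X' :: "'w \<Rightarrow> 'x" and Y Y' :: "'w \<Rightarrow> 'y::metric_space"
  assumes copy_indep: "indep_var (borel \<Otimes>\<^sub>M borel) (\<lambda>\<omega>. (X \<omega>, Y \<omega>)) (borel \<Otimes>\<^sub>M borel) (\<lambda>\<omega>. (X' \<omega>, Y' \<omega>))"
    and copy_distr: "distr M (borel \<Otimes>\<^sub>M borel) (\<lambda>\<omega>. (X' \<omega>, Y' \<omega>)) =
          distr M (borel \<Otimes>\<^sub>M borel) (\<lambda>\<omega>. (X \<omega>, Y \<omega>))"
    and meas_dist: "(\<lambda>\<omega>. dist (Y \<omega>) (Y' \<omega>)) \<in>
          borel_measurable (generated_field M (\<lambda>\<omega>. (Y \<omega>, Y' \<omega>)) (borel \<Otimes>\<^sub>M borel))"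
    and wire_integrable:
      "\<And>g h. integrable M (\<lambda>\<omega>. dist (Y \<omega>) (Y' \<omega>) * (centered h (X \<omega>) * centered g (X' \<omega>)))"
begin

lemma meas_XY: "(\<lambda>\<omega>. (X \<omega>, Y \<omega>)) \<in> measurable M (borel \<Otimes>\<^sub>M borel)"
  and meas_X'Y': "(\<lambda>\<omega>. (X' \<omega>, Y' \<omega>)) \<in> measurable M (borel \<Otimes>\<^sub>M borel)"
  using copy_indep unfolding indep_var_distribution_eq by auto

lemma meas_Y: "Y \<in> borel_measurable M" and meas_Y': "Y' \<in> borel_measurable M"
  using measurable_compose[OF meas_XY measurable_snd] measurable_compose[OF meas_X'Y' measurable_snd]
  by simp_all

lemma integrable_copy_iff:
  fixes q :: "'x \<times> 'y \<Rightarrow> real"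
  assumes "q \<in> borel_measurable (borel \<Otimes>\<^sub>M borel)"
  shows "integrable M (\<lambda>\<omega>. q (X' \<omega>, Y' \<omega>)) \<longleftrightarrow> integrable M (\<lambda>\<omega>. q (X \<omega>, Y \<omega>))"
  using integrable_distr_eq[OF meas_XY assms] integrable_distr_eq[OF meas_X'Y' assms]
  by (simp add: copy_distr)

lemma integral_copy:
  fixes q :: "'x \<times> 'y \<Rightarrow> real"
  assumes "q \<in> borel_measurable (borel \<Otimes>\<^sub>M borel)"
  shows "(\<integral>\<omega>. q (X' \<omega>, Y' \<omega>) \<partial>M) = (\<integral>\<omega>. q (X \<omega>, Y \<omega>) \<partial>M)"
  using integral_distr[OF meas_XY assms] integral_distr[OF meas_X'Y' assms]
  by (simp add: copy_distr)

lemma centered_fst_measurable [measurable]: "(\<lambda>z. centered h (fst z)) \<in> borel_measurable (borel \<Otimes>\<^sub>M borel)"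
  by (rule measurable_compose[OF measurable_fst centered_measurable])

lemma dist_measurable [measurable]: "(\<lambda>y :: 'y. dist y y0) \<in> borel_measurable borel"
  by (intro borel_measurable_continuous_onI continuous_intros)

lemma dist_snd_measurable [measurable]:
  "(\<lambda>z :: 'x \<times> 'y. dist (snd z) y0) \<in> borel_measurable (borel \<Otimes>\<^sub>M borel)"
  by (rule measurable_compose[OF measurable_snd dist_measurable])

lemma integrable_centered_copy: "integrable M (\<lambda>\<omega>. centered h (X' \<omega>))"
  and integral_centered_copy: "(\<integral>\<omega>. centered h (X' \<omega>) \<partial>M) = 0"
  using integrable_copy_iff[of "\<lambda>z. centered h (fst z)"] integral_copy[of "\<lambda>z. centered h (fst z)"]
    integrable_centered integral_centered by simp_all

text \<open>Truncating by \<open>dist (Y \<omega>) y0 \<le> K\<close> lets the triangle inequality replace \<open>dist (Y \<omega>) (Y' \<omega>)\<close> by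
  \<open>dist (Y' \<omega>) y0\<close>, which independence then separates from the factor in \<open>(X, Y)\<close>.\<close>

lemma integrable_centered_mult_dist:
  assumes nz: "\<not> (AE \<omega> in M. centered g (X \<omega>) = 0)"
  shows "integrable M (\<lambda>\<omega>. centered h (X' \<omega>) * dist (Y' \<omega>) y0)"
    and "integrable M (\<lambda>\<omega>. centered h (X \<omega>) * dist (Y \<omega>) y0)"
proof -
  define p where "p K z = (if dist (snd z) y0 \<le> K then centered g (fst z) else 0)" for K :: real and z :: "'x \<times> 'y"
  define q where "q z = centered h (fst z) * dist (snd z) y0" for z :: "'x \<times> 'y"
  have p: "p K \<in> borel_measurable (borel \<Otimes>\<^sub>M borel)" for K
    unfolding p_def by measurable
  have q: "q \<in> borel_measurable (borel \<Otimes>\<^sub>M borel)" unfolding q_def by measurable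
  have pX: "(\<lambda>\<omega>. p K (X \<omega>, Y \<omega>)) \<in> borel_measurable M" for K
    by (rule measurable_compose[OF meas_XY p])
  have qX: "(\<lambda>\<omega>. q (X' \<omega>, Y' \<omega>)) \<in> borel_measurable M"
    by (rule measurable_compose[OF meas_X'Y' q])
  \<comment> \<open>If every truncation vanished almost surely, so would
    \<open>centered g (X \<omega>)\<close>, since each \<open>Y \<omega>\<close> lies within some
    natural distance of \<open>y0\<close>.\<close>
  have "\<exists>n. \<not> (AE \<omega> in M. p (real n) (X \<omega>, Y \<omega>) = 0)"
  proof (rule ccontr)
    assume "\<nexists>n. \<not> (AE \<omega> in M. p (real n) (X \<omega>, Y \<omega>) = 0)"
    then have "AE \<omega> in M. \<forall>n. p (real n) (X \<omega>, Y \<omega>) = 0" by (simp add: AE_all_countable)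
    then have "AE \<omega> in M. centered g (X \<omega>) = 0"
    proof eventually_elim
      case (elim \<omega>)
      obtain n where "dist (Y \<omega>) y0 \<le> real n" using real_arch_simple by blast
      then show ?case using elim[rule_format, of n] by (simp add: p_def)
    qed
    with nz show False by blast
  qed
  then obtain n where n: "\<not> (AE \<omega> in M. p (real n) (X \<omega>, Y \<omega>) = 0)" by blast
  have int1: "integrable M (\<lambda>\<omega>. centered g (X \<omega>) * centered h (X' \<omega>))"
    using indep_var_comp_integrals(1)[OF copy_indep centered_fst_measurable[of g] centered_fst_measurable[of h]]
      integrable_centered integrable_centered_copy by simp
  have "integrable M (\<lambda>\<omega>. p (real n) (X \<omega>, Y \<omega>) * q (X' \<omega>, Y' \<omega>))"
  proof (rule Bochner_Integration.integrable_bound)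
    show "integrable M (\<lambda>\<omega>. \<bar>dist (Y \<omega>) (Y' \<omega>) * (centered g (X \<omega>) * centered h (X' \<omega>))\<bar>
        + real n * \<bar>centered g (X \<omega>) * centered h (X' \<omega>)\<bar>)"
      using wire_integrable int1 by simp
    have "\<bar>p (real n) (X \<omega>, Y \<omega>) * q (X' \<omega>, Y' \<omega>)\<bar> \<le>
        \<bar>dist (Y \<omega>) (Y' \<omega>) * (centered g (X \<omega>) * centered h (X' \<omega>))\<bar>
        + real n * \<bar>centered g (X \<omega>) * centered h (X' \<omega>)\<bar>" for \<omega>
    proof (cases "dist (Y \<omega>) y0 \<le> real n")
      case True
      then have "dist (Y' \<omega>) y0 \<le> dist (Y \<omega>) (Y' \<omega>) + real n"
        using dist_triangle[of "Y' \<omega>" y0 "Y \<omega>"] by (simp add: dist_commute)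
      then have "dist (Y' \<omega>) y0 * \<bar>centered g (X \<omega>) * centered h (X' \<omega>)\<bar> \<le>
          (dist (Y \<omega>) (Y' \<omega>) + real n) * \<bar>centered g (X \<omega>) * centered h (X' \<omega>)\<bar>"
        by (rule mult_right_mono) simp
      then show ?thesis using True by (simp add: p_def q_def abs_mult algebra_simps)
    qed (simp add: p_def)
    then show "AE \<omega> in M. norm (p (real n) (X \<omega>, Y \<omega>) * q (X' \<omega>, Y' \<omega>)) \<le>
        norm (\<bar>dist (Y \<omega>) (Y' \<omega>) * (centered g (X \<omega>) * centered h (X' \<omega>))\<bar>
        + real n * \<bar>centered g (X \<omega>) * centered h (X' \<omega>)\<bar>)"
      unfolding real_norm_def by (intro always_eventually allI order_trans[OF _ abs_ge_self])
  qed (use pX qX in simp)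
  from indep_var_integrable_factor[OF copy_indep p q this n]
  have "integrable M (\<lambda>\<omega>. q (X' \<omega>, Y' \<omega>))" .
  with integrable_copy_iff[OF q]
  show "integrable M (\<lambda>\<omega>. centered h (X' \<omega>) * dist (Y' \<omega>) y0)"
    and "integrable M (\<lambda>\<omega>. centered h (X \<omega>) * dist (Y \<omega>) y0)" by (simp_all add: q_def)
qed

text \<open>Factorization through \<open>(Y, Y')\<close> supplies a product-measurable version of
  the distance, to which Fubini can be applied.\<close>

lemma dist_factor:
  obtains D where "D \<in> borel_measurable (borel \<Otimes>\<^sub>M borel)"
    "AE \<omega> in M. dist (Y \<omega>) (Y' \<omega>) = D (Y \<omega>, Y' \<omega>)"
  using generated_field_factor[OF measurable_Pair[OF meas_Y meas_Y'] meas_dist] by blast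

text \<open>Integrating out \<open>(X', Y')\<close> first leaves a bounded function of
  \<open>Y\<close>, and its conditional expectation given \<open>F\<close> is \<open>w\<close>. The
  case split mirrors \<open>integrable_centered_mult_dist\<close>, which yields the moments of the
  distance when \<open>centered g (X \<omega>)\<close> is not almost surely zero; in the degenerate
  case \<open>w = 0\<close> serves.\<close>

lemma wire_bounded_representation:
  assumes F: "subalgebra M F" and ci: "cond_independent M F Y borel X borel"
  obtains w C where "w \<in> borel_measurable F" "AE \<omega> in M. \<bar>w \<omega>\<bar> \<le> C"
    "\<And>h. (\<integral>\<omega>. dist (Y \<omega>) (Y' \<omega>) * (centered h (X \<omega>) * centered g (X' \<omega>)) \<partial>M) =
       (\<integral>\<omega>. centered h (X \<omega>) * w \<omega> \<partial>M)"
proof (cases "AE \<omega> in M. centered g (X \<omega>) = 0")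
  case True
  have "AE z in distr M (borel \<Otimes>\<^sub>M borel) (\<lambda>\<omega>. (X' \<omega>, Y' \<omega>)). centered g (fst z) = 0"
    unfolding copy_distr using True by (subst AE_distr_iff[OF meas_XY]) auto
  then have "AE \<omega> in M. centered g (X' \<omega>) = 0"
    by (subst (asm) AE_distr_iff[OF meas_X'Y']) auto
  then have "AE \<omega> in M. dist (Y \<omega>) (Y' \<omega>) * (centered h (X \<omega>) * centered g (X' \<omega>)) = 0" for h
    by eventually_elim simp
  then have "(\<integral>\<omega>. dist (Y \<omega>) (Y' \<omega>) * (centered h (X \<omega>) * centered g (X' \<omega>)) \<partial>M) = 0" for h
    by (rule integral_eq_zero_AE)
  then show ?thesis by (intro that[of "\<lambda>_. 0" 0]) auto
next
  case False
  interpret finite_measure_subalgebra M F using F by unfold_locales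
  fix y0 :: 'y
  note int_dist = integrable_centered_mult_dist[OF False, of _ y0]
  obtain D where D: "D \<in> borel_measurable (borel \<Otimes>\<^sub>M borel)"
    "AE \<omega> in M. dist (Y \<omega>) (Y' \<omega>) = D (Y \<omega>, Y' \<omega>)" by (rule dist_factor)
  \<comment> \<open>\<open>D (y, y') - dist y y0\<close>, clamped to the interval of radius
    \<open>dist y' y0\<close> about zero. By the triangle inequality the clamp is almost surely
    inactive at \<open>(Y, Y')\<close>, while the bound \<open>cl_le\<close> holds at every point,
    although \<open>D\<close> is known to be the distance only almost surely.\<close>
  define cl where
    "cl y y' = max (- dist y' y0) (min (dist y' y0) (D (y, y') - dist y y0))" for y y' :: 'y
  have cl_le: "\<bar>cl y y'\<bar> \<le> dist y' y0" for y y'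
    using zero_le_dist[of y' y0] by (auto simp: cl_def max_def min_def)
  have cl_eq: "AE \<omega> in M. cl (Y \<omega>) (Y' \<omega>) = dist (Y \<omega>) (Y' \<omega>) - dist (Y \<omega>) y0"
    using D(2)
  proof eventually_elim
    case (elim \<omega>)
    have "\<bar>dist (Y \<omega>) (Y' \<omega>) - dist (Y \<omega>) y0\<bar> \<le> dist (Y' \<omega>) y0"
      using dist_triangle[of "Y \<omega>" "Y' \<omega>" y0] dist_triangle[of "Y \<omega>" y0 "Y' \<omega>"]
      by (simp add: dist_commute abs_le_iff)
    then show ?case unfolding cl_def elim[symmetric] by auto
  qed
  have cl: "(\<lambda>(y, y'). cl y y') \<in> borel_measurable (borel \<Otimes>\<^sub>M borel)"
    unfolding cl_def using D(1) by measurable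
  define c where "c zz = centered g (fst (snd zz)) * cl (snd (fst zz)) (snd (snd zz))"
    for zz :: "('x \<times> 'y) \<times> ('x \<times> 'y)"
  have cl2: "(\<lambda>zz :: ('x \<times> 'y) \<times> ('x \<times> 'y). cl (snd (fst zz)) (snd (snd zz)))
      \<in> borel_measurable ((borel \<Otimes>\<^sub>M borel) \<Otimes>\<^sub>M (borel \<Otimes>\<^sub>M borel))"
    using measurable_compose[OF _ cl, of "\<lambda>zz :: ('x \<times> 'y) \<times> ('x \<times> 'y). (snd (fst zz), snd (snd zz))"] by simp
  have c: "c \<in> borel_measurable ((borel \<Otimes>\<^sub>M borel) \<Otimes>\<^sub>M (borel \<Otimes>\<^sub>M borel))"
    unfolding c_def using cl2 measurable_compose[OF measurable_snd centered_fst_measurable]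
    by (intro borel_measurable_times)
  have XYXY: "(\<lambda>\<omega>. ((X \<omega>, Y \<omega>), (X' \<omega>, Y' \<omega>))) \<in> measurable M ((borel \<Otimes>\<^sub>M borel) \<Otimes>\<^sub>M (borel \<Otimes>\<^sub>M borel))"
    by (rule measurable_Pair[OF meas_XY meas_X'Y'])
  have cX: "(\<lambda>\<omega>. c ((X \<omega>, Y \<omega>), (X' \<omega>, Y' \<omega>))) \<in> borel_measurable M"
    by (rule measurable_compose[OF XYXY c])
  have c_le: "\<bar>c (z, z')\<bar> \<le> \<bar>centered g (fst z') * dist (snd z') y0\<bar>" for z z'
    using cl_le[of "snd z" "snd z'"] by (simp add: c_def abs_mult mult_left_mono)
  have int_c: "integrable M (\<lambda>\<omega>. c ((X \<omega>, Y \<omega>), (X' \<omega>, Y' \<omega>)))"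
    by (rule Bochner_Integration.integrable_bound[OF int_dist(1)[of g] cX])
       (use c_le in \<open>force intro: always_eventually\<close>)
  \<comment> \<open>\<open>c\<close> ignores the first coordinate of its first argument, so
    \<open>undefined\<close> is a mere placeholder there and the integral depends on
    \<open>y\<close> alone.\<close>
  define a where "a y = (\<integral>\<omega>. c ((undefined, y), (X' \<omega>, Y' \<omega>)) \<partial>M)" for y
  have a: "a \<in> borel_measurable borel"
    unfolding a_def
    by (rule measurable_compose[OF _ indep_var_fubini(3)[OF copy_indep c int_c]]) simp
  define C where "C = (\<integral>\<omega>. \<bar>centered g (X' \<omega>) * dist (Y' \<omega>) y0\<bar> \<partial>M)"
  have a_le: "\<bar>a y\<bar> \<le> C" for y
  proof -
    have "(\<lambda>\<omega>. c ((undefined, y), (X' \<omega>, Y' \<omega>))) \<in> borel_measurable M"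
      by (rule measurable_compose[OF _ c]) (use meas_X'Y' in simp)
    then have "integrable M (\<lambda>\<omega>. c ((undefined, y), (X' \<omega>, Y' \<omega>)))"
      by (rule Bochner_Integration.integrable_bound[OF int_dist(1)[of g]])
         (use c_le in \<open>force intro: always_eventually\<close>)
    then have "(\<integral>\<omega>. \<bar>c ((undefined, y), (X' \<omega>, Y' \<omega>))\<bar> \<partial>M) \<le> C"
      unfolding C_def using int_dist(1)[of g] c_le[of "(undefined, y)"] by (intro integral_mono) force+
    then show ?thesis unfolding a_def by (rule order_trans[OF integral_abs_bound])
  qed
  have rep: "(\<integral>\<omega>. dist (Y \<omega>) (Y' \<omega>) * (centered h (X \<omega>) * centered g (X' \<omega>)) \<partial>M) =
      (\<integral>\<omega>. centered h (X \<omega>) * real_cond_exp M F (\<lambda>\<omega>. a (Y \<omega>)) \<omega> \<partial>M)" for h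
  proof -
    let ?W = "\<lambda>\<omega>. dist (Y \<omega>) (Y' \<omega>) * (centered h (X \<omega>) * centered g (X' \<omega>))"
    let ?e = "\<lambda>zz. centered h (fst (fst zz)) * c zz"
    let ?q = "\<lambda>z. centered h (fst z) * dist (snd z) y0"
    have q: "?q \<in> borel_measurable (borel \<Otimes>\<^sub>M borel)" by measurable
    have "integrable M (\<lambda>\<omega>. ?q (X \<omega>, Y \<omega>))" "integrable M (\<lambda>\<omega>. centered g (fst (X' \<omega>, Y' \<omega>)))"
      using int_dist(2)[of h] integrable_centered_copy by simp_all
    note sep = indep_var_comp_integrals[OF copy_indep q centered_fst_measurable this]
    have int_q: "integrable M (\<lambda>\<omega>. centered h (X \<omega>) * dist (Y \<omega>) y0 * centered g (X' \<omega>))"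
      using sep(1) by simp
    \<comment> \<open>Independence and the zero mean of \<open>centered g (X' \<omega>)\<close>:
      subtracting \<open>dist (Y \<omega>) y0\<close> from the distance leaves the integral
      unchanged.\<close>
    have q0: "(\<integral>\<omega>. centered h (X \<omega>) * dist (Y \<omega>) y0 * centered g (X' \<omega>) \<partial>M) = 0"
      using sep(2) by (simp add: integral_centered_copy)
    have e: "?e \<in> borel_measurable ((borel \<Otimes>\<^sub>M borel) \<Otimes>\<^sub>M (borel \<Otimes>\<^sub>M borel))"
      using c measurable_compose[OF measurable_fst centered_fst_measurable]
      by (intro borel_measurable_times)
    have eX: "(\<lambda>\<omega>. ?e ((X \<omega>, Y \<omega>), (X' \<omega>, Y' \<omega>))) \<in> borel_measurable M"
      by (rule measurable_compose[OF XYXY e])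
    have e_eq: "AE \<omega> in M. ?e ((X \<omega>, Y \<omega>), (X' \<omega>, Y' \<omega>)) =
        ?W \<omega> - centered h (X \<omega>) * dist (Y \<omega>) y0 * centered g (X' \<omega>)"
      using cl_eq by eventually_elim (simp add: c_def left_diff_distrib right_diff_distrib mult_ac)
    have int_W: "integrable M (\<lambda>\<omega>. ?W \<omega> - centered h (X \<omega>) * dist (Y \<omega>) y0 * centered g (X' \<omega>))"
      using wire_integrable int_q by (rule Bochner_Integration.integrable_diff)
    have int_e: "integrable M (\<lambda>\<omega>. ?e ((X \<omega>, Y \<omega>), (X' \<omega>, Y' \<omega>)))"
      using integrable_cong_AE_imp[OF int_W eX] e_eq by (simp add: eq_commute)
    have "(\<integral>\<omega>. ?W \<omega> \<partial>M) =
        (\<integral>\<omega>. ?W \<omega> - centered h (X \<omega>) * dist (Y \<omega>) y0 * centered g (X' \<omega>) \<partial>M)"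
      using Bochner_Integration.integral_diff[OF wire_integrable int_q, of h g] q0 by simp
    also have "\<dots> = (\<integral>\<omega>. ?e ((X \<omega>, Y \<omega>), (X' \<omega>, Y' \<omega>)) \<partial>M)"
      using e_eq by (intro integral_cong_AE borel_measurable_integrable[OF int_W] eX) (auto simp: eq_commute)
    also have "\<dots> = (\<integral>\<omega>. (\<integral>\<omega>'. ?e ((X \<omega>, Y \<omega>), (X' \<omega>', Y' \<omega>')) \<partial>M) \<partial>M)"
      by (rule indep_var_fubini(1)[OF copy_indep e int_e])
    also have "\<dots> = (\<integral>\<omega>. centered h (X \<omega>) * a (Y \<omega>) \<partial>M)"
      by (simp add: a_def c_def)
    also have "\<dots> = (\<integral>\<omega>. centered h (X \<omega>) * real_cond_exp M F (\<lambda>\<omega>. a (Y \<omega>)) \<omega> \<partial>M)"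
      by (rule cond_independent_integral[OF F ci meas_X meas_Y a a_le centered_measurable integrable_centered])
    finally show ?thesis .
  qed
  have "AE \<omega> in M. \<bar>real_cond_exp M F (\<lambda>\<omega>. a (Y \<omega>)) \<omega>\<bar> \<le> C"
    by (rule real_cond_exp_bounded(2)[OF measurable_compose[OF meas_Y a] a_le])
  with rep show ?thesis by (intro that[of "real_cond_exp M F (\<lambda>\<omega>. a (Y \<omega>))"]) auto
qed

end

section \<open>Inclusion of the closed range in the central class\<close>

theorem proposition3:
  fixes M :: "'w measure"
    and X X' :: "'w \<Rightarrow> real^'p"
    and Y Y' :: "'w \<Rightarrow> 'y::metric_space"
    and \<kappa> :: "real^'p \<Rightarrow> real^'p \<Rightarrow> real"
    and val :: "'h::{real_inner,complete_space} \<Rightarrow> real^'p \<Rightarrow> real"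
    and f :: "real^'p \<Rightarrow> real^'d"
  defines "k \<equiv> kernel_section val \<kappa>"
  defines "\<Sigma> \<equiv> cov_op M k X"
  defines "\<Lambda> \<equiv> wire_op M k X Y X' Y'"
  defines "F \<equiv> generated_field M (\<lambda>\<omega>. f (X \<omega>)) borel"
  defines "G \<equiv> central_class val X F"
  assumes prob: "prob_space M"
    and meas_X: "X \<in> borel_measurable M"
    and meas_Y: "Y \<in> borel_measurable M"
    and copy_indep: "prob_space.indep_var M
          (borel \<Otimes>\<^sub>M borel) (\<lambda>\<omega>. (X \<omega>, Y \<omega>)) (borel \<Otimes>\<^sub>M borel) (\<lambda>\<omega>. (X' \<omega>, Y' \<omega>))"
    and copy_distr: "distr M (borel \<Otimes>\<^sub>M borel) (\<lambda>\<omega>. (X' \<omega>, Y' \<omega>)) =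
          distr M (borel \<Otimes>\<^sub>M borel) (\<lambda>\<omega>. (X \<omega>, Y \<omega>))"
    and pd: "positive_definite_kernel \<kappa>"
    and meas_kernel: "\<And>x. (\<lambda>y. \<kappa> y x) \<in> borel_measurable borel"
    and rkhs: "is_rkhs val \<kappa>"
    and meas_dist: "(\<lambda>\<omega>. dist (Y \<omega>) (Y' \<omega>)) \<in>
          borel_measurable (generated_field M (\<lambda>\<omega>. (Y \<omega>, Y' \<omega>)) (borel \<Otimes>\<^sub>M borel))"
    and wire_defined: "\<And>g. weakly_integrable M (\<lambda>\<omega>. wire_integrand M k X Y X' Y' \<omega> g)"
    and central: "central_sdr_map M X Y f"
    and cond_i: "integrable M (\<lambda>\<omega>. \<kappa> (X \<omega>) (X \<omega>))"
    and cond_ii: "\<exists>!S. is_inverse_representation \<Sigma> \<Lambda> S"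
    and cond_iii: "L2_dense_in (distr M borel X) (val ` G) (L2_measurable_functions M X F)"
  shows "closure (range (inverse_comp \<Sigma> \<Lambda>)) \<subseteq> G"
proof -
  interpret prob_space M by (rule prob)
  interpret rkhs_random_element M X \<kappa> val
    by unfold_locales (rule meas_X rkhs meas_kernel cond_i)+
  have wire: "weakly_integrable M (\<lambda>\<omega>. wire_integrand M (kernel_section val \<kappa>) X Y X' Y' \<omega> g)" for g
    using wire_defined unfolding k_def .
  interpret rkhs_copies M X \<kappa> val X' Y Y'
    by unfold_locales (rule copy_indep copy_distr meas_dist inner_wire_op(1)[OF wire])+
  have sdr: "sdr_map M X Y f" using central unfolding central_sdr_map_def by blast
  then have f: "f \<in> borel_measurable borel" and ci: "cond_independent M F Y borel X borel"
    unfolding sdr_map_def F_def by blast+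
  have F: "subalgebra M F"
    unfolding F_def by (intro subalgebra_generated_field measurable_compose[OF meas_X f])
  \<comment> \<open>Pairing the equation with every \<open>h\<close> turns it into the covariance
    identity that \<open>central_class_if_cov_bounded\<close> asks for, with the bounded
    \<open>w\<close> representing the pairing with \<open>\<Lambda> g\<close>.\<close>
  have step: "u \<in> G" if eq: "\<Lambda> g = \<Sigma> u" for g u
  proof -
    obtain w C where w: "w \<in> borel_measurable F" "AE \<omega> in M. \<bar>w \<omega>\<bar> \<le> C"
      and rep: "\<And>h. (\<integral>\<omega>. dist (Y \<omega>) (Y' \<omega>) * (centered h (X \<omega>) * centered g (X' \<omega>)) \<partial>M) =
        (\<integral>\<omega>. centered h (X \<omega>) * w \<omega> \<partial>M)"
      using wire_bounded_representation[OF F ci, of g] by blast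
    have cov: "(\<integral>\<omega>. centered h (X \<omega>) * centered u (X \<omega>) \<partial>M) =
        - (\<integral>\<omega>. centered h (X \<omega>) * w \<omega> \<partial>M)" for h
    proof -
      have "(\<integral>\<omega>. centered h (X \<omega>) * centered u (X \<omega>) \<partial>M) = h \<bullet> \<Sigma> u"
        unfolding \<Sigma>_def k_def by (rule inner_cov_op[symmetric])
      also have "\<dots> = h \<bullet> \<Lambda> g" by (simp only: eq)
      also have "\<dots> = - (\<integral>\<omega>. centered h (X \<omega>) * w \<omega> \<partial>M)"
        unfolding \<Lambda>_def k_def rep[symmetric] by (rule inner_wire_op(2)[OF wire])
      finally show ?thesis .
    qed
    show ?thesis
      unfolding G_def F_def
      by (rule central_class_if_cov_bounded[OF f cond_iii[unfolded G_def F_def] w[unfolded F_def] cov])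
  qed
  \<comment> \<open>\<open>inverse_comp\<close> is a definite description, so unique existence in
    \<open>cond_ii\<close> is what gives it the defining properties.\<close>
  have "is_inverse_representation \<Sigma> \<Lambda> (inverse_comp \<Sigma> \<Lambda>)"
    unfolding inverse_comp_def using cond_ii by (rule theI')
  then have S: "\<Lambda> = \<Sigma> \<circ> inverse_comp \<Sigma> \<Lambda>"
    unfolding is_inverse_representation_def Let_def by (elim conjE)
  have "inverse_comp \<Sigma> \<Lambda> g \<in> G" for g
    using fun_cong[OF S, of g] unfolding comp_apply by (rule step)
  then have "range (inverse_comp \<Sigma> \<Lambda>) \<subseteq> G" by (rule image_subsetI)
  moreover have "closed G"
    unfolding G_def central_class_def by (rule rkhs_closed_measurable[OF rkhs])
  ultimately show ?thesis by (rule closure_minimal)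
qed

end
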